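(* Let $X=(X,d,\mu)$ be a metric measure space satisfying the standing assumptions of the context (in particular $\mu$ is doubling). Let $1\le p\le q<\infty$, $0<s<1$ and $1\le t<\infty$. Assume that the space $X$ is complete and supports a $(s,q,p,t)$-Poincaré inequality, with constants $c_P>0$ and $\lambda\ge1$, and that $\mu$ is reverse doubling, with constants $0<\kappa<1$ and $0<c_R<1$. Let $E\subset X$ be a closed set with $\overline{\operatorname{co\,dim}}_A(E)<sp$. Then there is a constant $C>0$ such that \[ \biggl(\frac1{\mu(B)}\int_B|u(x)|^q\,d\mu(x)\biggr)^{p/q}\le C R^{sp}\,\frac1{\mu(\lambda B)}\int_{\lambda B}\biggl(\int_{\lambda B}\frac{|u(x)-u(y)|^t}{d(x,y)^{st}\mu(B(x,d(x,y)))}\,d\mu(y)\biggr)^{p/t}d\mu(x) \] whenever $u\colon X\to\mathbb R$ is a continuous function such that $u=0$ on $E$ and $B=B(w,R)$ is a ball with $w\in E$ and $0<R<\operatorname{diam}(E)/2$.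
   Context: Standing assumptions: $X=(X,d,\mu)$ is a metric measure space with at least two points, where $\mu$ is a Borel measure supported on $X$ such that $\mu(\{x\})=0$ for all $x\in X$ and $0<\mu(B)<\infty$ for all open balls $B=B(x,r)=\{y\in X: d(x,y)<r\}$, $r>0$. Each ball has a fixed center and radius, and $\lambda B(x,r)=B(x,\lambda r)$. The measure $\mu$ is doubling: there is $c_D\ge1$ such that $\mu(B(x,2r))\le c_D\,\mu(B(x,r))$ for all $x\in X$, $r>0$. Reverse doubling with constants $0<\kappa<1$ and $0<c_R<1$: $\mu(B(x,\kappa r))\le c_R\,\mu(B(x,r))$ for every $x\in X$ and $0<r<\operatorname{diam}(X)/2$. A function $u\colon X\to\mathbb R$ is integrable on balls if it is $\mu$-measurable and $\int_B|u|\,d\mu<\infty$ for every ball $B\subset X$; then $u_B=\frac1{\mu(B)}\int_B u\,d\mu$. $(s,q,p,t)$-Poincaré inequality ($1\le p,q,t<\infty$, $0<s<1$): $X$ supports it with constants $c_P>0$ and $\lambda\ge1$ if \[ \biggl(\frac1{\mu(B)}\int_B|u(x)-u_B|^q\,d\mu(x)\biggr)^{1/q}\le c_Pr^s\biggl(\frac1{\mu(\lambda B)}\int_{\lambda B}\biggl(\int_{\lambda B}\frac{|u(x)-u(y)|^t}{d(x,y)^{st}\mu(B(x,d(x,y)))}\,d\mu(y)\biggr)^{p/t}d\mu(x)\biggr)^{1/p} \] for every ball $B=B(x_0,r)\subset X$ and all $u\colon X\to\mathbb R$ integrable on balls (in particular the left-hand side is finite if the right-hand side is finite). Upper Assouad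 codimension: for $E\subset X$ and $r>0$ let $E_r=\{x\in X:\operatorname{dist}(x,E)<r\}$. Then $\overline{\operatorname{co\,dim}}_A(E)$ is the infimum of all $Q\ge0$ for which there is $c>0$ such that \[ \frac{\mu(E_r\cap B(x,R))}{\mu(B(x,R))}\ge c\Bigl(\frac rR\Bigr)^Q \] for every $x\in E$ and all $0<r<R<\operatorname{diam}(E)$. If $E$ consists of one point, the restriction $R<\operatorname{diam}(E)$ is removed. *)

theory Defs
  imports "HOL-Analysis.Analysis"
begin

text \<open>Possibly infinite diameter; the library's real-valued \<open>diameter\<close> is meaningful only on
  bounded sets.\<close>

definition ediam :: "'a::metric_space set \<Rightarrow> ennreal" where
  "ediam S = (SUP x\<in>S. SUP y\<in>S. ennreal (dist x y))"

text \<open>Powers of extended nonnegative numbers, meant for exponents \<open>a > 0\<close>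
  (so \<open>0\<close> goes to \<open>0\<close> and \<open>\<infinity>\<close> to \<open>\<infinity>\<close>).\<close>

definition epowr :: "ennreal \<Rightarrow> real \<Rightarrow> ennreal" where
  "epowr x a = (if x = \<infinity> then \<infinity> else ennreal (enn2real x powr a))"

text \<open>The metric space is the whole type. That the measure is supported on the space is part of
  the condition that balls have positive measure.\<close>

definition metric_measure_space :: "'a::metric_space measure \<Rightarrow> bool" where
  "metric_measure_space \<mu> \<longleftrightarrow>
     (\<exists>x y :: 'a. x \<noteq> y) \<and>
     sets \<mu> = sets borel \<and>
     (\<forall>x. emeasure \<mu> {x} = 0) \<and>
     (\<forall>x r. 0 < r \<longrightarrow> 0 < emeasure \<mu> (ball x r) \<and> emeasure \<mu> (ball x r) < \<infinity>)"

definition doubling_measure :: "'a::metric_space measure \<Rightarrow> bool" where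
  "doubling_measure \<mu> \<longleftrightarrow>
     (\<exists>cD\<ge>1. \<forall>x r. 0 < r \<longrightarrow> measure \<mu> (ball x (2 * r)) \<le> cD * measure \<mu> (ball x r))"

definition reverse_doubling_measure :: "'a::metric_space measure \<Rightarrow> real \<Rightarrow> real \<Rightarrow> bool" where
  "reverse_doubling_measure \<mu> \<kappa> cR \<longleftrightarrow>
     (\<forall>x r. 0 < r \<and> ennreal r < ediam (UNIV :: 'a set) / 2 \<longrightarrow>
        measure \<mu> (ball x (\<kappa> * r)) \<le> cR * measure \<mu> (ball x r))"

text \<open>As usual, \<open>\<mu>\<close>-measurable means measurable with respect to the completion of the Borel
  measure \<open>\<mu>\<close>.\<close>

definition integrable_on_balls :: "'a::metric_space measure \<Rightarrow> ('a \<Rightarrow> real) \<Rightarrow> bool" where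
  "integrable_on_balls \<mu> u \<longleftrightarrow>
     u \<in> borel_measurable (completion \<mu>) \<and>
     (\<forall>x r. 0 < r \<longrightarrow> set_integrable (completion \<mu>) (ball x r) u)"

definition ball_average :: "'a::metric_space measure \<Rightarrow> 'a set \<Rightarrow> ('a \<Rightarrow> real) \<Rightarrow> real" where
  "ball_average \<mu> B u = set_lebesgue_integral (completion \<mu>) B u / measure \<mu> B"

text \<open>On the diagonal \<open>x = y\<close> the fraction is \<open>0 / 0 = 0\<close>; this is harmless since points have
  measure zero. The integrals are taken over the completion for the same reason as above; for
  nonnegative integrals this does not change the value (\<open>nn_integral_completion\<close>).\<close>

definition frac_energy ::
  "'a::metric_space measure \<Rightarrow> real \<Rightarrow> real \<Rightarrow> real \<Rightarrow> 'a set \<Rightarrow> ('a \<Rightarrow> real) \<Rightarrow> ennreal" where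
  "frac_energy \<mu> s p t A u =
     (\<integral>\<^sup>+x\<in>A. epowr
        (\<integral>\<^sup>+y\<in>A. ennreal (\<bar>u x - u y\<bar> powr t /
            (dist x y powr (s * t) * measure \<mu> (ball x (dist x y)))) \<partial>(completion \<mu>))
        (p / t) \<partial>(completion \<mu>))"

definition poincare_inequality ::
  "'a::metric_space measure \<Rightarrow> real \<Rightarrow> real \<Rightarrow> real \<Rightarrow> real \<Rightarrow> real \<Rightarrow> real \<Rightarrow> bool" where
  "poincare_inequality \<mu> s q p t cP \<Lambda> \<longleftrightarrow>
     (\<forall>x0 r u. 0 < r \<and> integrable_on_balls \<mu> u \<longrightarrow>
        epowr ((\<integral>\<^sup>+x\<in>ball x0 r. ennreal (\<bar>u x - ball_average \<mu> (ball x0 r) u\<bar> powr q) \<partial>(completion \<mu>))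
                 / emeasure \<mu> (ball x0 r)) (1 / q)
        \<le> ennreal (cP * r powr s) *
            epowr (frac_energy \<mu> s p t (ball x0 (\<Lambda> * r)) u / emeasure \<mu> (ball x0 (\<Lambda> * r))) (1 / p))"

text \<open>The infimum is taken in the extended reals, so that it is \<open>\<infinity>\<close> if no exponent is admissible.\<close>

definition upper_assouad_codim :: "'a::metric_space measure \<Rightarrow> 'a set \<Rightarrow> ereal" where
  "upper_assouad_codim \<mu> E =
     Inf {ereal Q | Q. 0 \<le> Q \<and>
       (\<exists>c>0. \<forall>x\<in>E. \<forall>r R. 0 < r \<and> r < R \<and> (is_singleton E \<or> ennreal R < ediam E) \<longrightarrow>
          measure \<mu> ({y. infdist y E < r} \<inter> ball x R) / measure \<mu> (ball x R) \<ge> c * (r / R) powr Q)}"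

end

(*
  Upper codimension of E below sp makes E branching: for some small epsilon and delta > epsilon^(sp),
  every ball B(x,r) centred on E contains disjoint balls B(y, epsilon r) centred on E with total
  measure at least delta mu(B(x,r)). Distributing the mass of B(w,R) down the resulting tree in
  proportion to measure gives, in generation n, probability weights W(x) with
  W(x) <= delta^(-n) mu(B(x, epsilon^n R)) / mu(B(w,R)).
  Telescoping the averages of u along the tree bounds |u_B| by the sum over n of the W-mean
  oscillations plus the W-mean of |u_B(x, epsilon^n R)| in the last generation, which tends to 0
  since u is uniformly continuous on compact balls and vanishes on E. The Poincare inequality,
  Jensen and bounded overlap bound the n-th oscillation by a constant times
  (epsilon^s / delta^(1/p))^n R^s (energy mean)^(1/p), a convergent geometric series.
  A last use of the Poincare inequality on B passes from |u_B| to the L^q mean of u.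
*)
theory Submission
  imports Defs
begin

section \<open>A substitute for Jensen's inequality and integrals without measurability\<close>

text \<open>A substitute for Jensen's inequality: averaging it with \<open>b\<close> the \<open>q\<close>-mean of \<open>a\<close> bounds the mean
  by twice the \<open>q\<close>-mean.\<close>

lemma le_add_powr_mult_powr:
  fixes a b q :: real
  assumes "0 \<le> a" "0 < b" "1 \<le> q"
  shows "a \<le> b + a powr q * b powr (1 - q)"
proof (cases "a \<le> b")
  case False
  \<comment> \<open>For \<open>b < a\<close> the exponent \<open>1 - q <= 0\<close> makes the power
    decreasing, so the second summand alone already dominates \<open>a\<close>.\<close>
  with assms have "a powr q * a powr (1 - q) \<le> a powr q * b powr (1 - q)"
    by (intro mult_left_mono powr_mono2') auto
  moreover have "a powr q * a powr (1 - q) = a"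
    using False assms by (simp flip: powr_add)
  ultimately show ?thesis
    using assms by simp
qed (use assms in \<open>simp add: add_increasing2\<close>)

text \<open>Averaging the pointwise inequality against weights of total mass one: the threshold
  contributes \<open>b\<close>, and the powers contribute at most
  \<open>b powr (1 - q) * b powr q = b\<close>.\<close>

lemma sum_weighted_le_of_sum_powr_le:
  fixes w f :: "'i \<Rightarrow> real"
  assumes "0 < b" "1 \<le> q" "sum w I = 1"
    and nonneg: "\<And>i. i \<in> I \<Longrightarrow> 0 \<le> w i" "\<And>i. i \<in> I \<Longrightarrow> 0 \<le> f i"
    and le: "(\<Sum>i\<in>I. w i * f i powr q) \<le> b powr q"
  shows "(\<Sum>i\<in>I. w i * f i) \<le> 2 * b"
proof -
  have "(\<Sum>i\<in>I. w i * f i) \<le> (\<Sum>i\<in>I. w i * (b + f i powr q * b powr (1 - q)))"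
    using assms by (intro sum_mono mult_left_mono le_add_powr_mult_powr) auto
  also have "\<dots> = b * sum w I + b powr (1 - q) * (\<Sum>i\<in>I. w i * f i powr q)"
    by (simp add: algebra_simps sum.distrib sum_distrib_left)
  also have "\<dots> \<le> b + b powr (1 - q) * b powr q"
    using assms by (simp add: mult_left_mono)
  also have "b powr (1 - q) * b powr q = b"
    using assms by (simp flip: powr_add)
  finally show ?thesis by simp
qed

text \<open>No measurability is assumed in the next three lemmas: as a supremum over simple functions from
  below, the integral is always superadditive. This avoids proving joint measurability of the kernel
  in \<^const>\<open>frac_energy\<close>, in a space whose type carries no second countability.\<close>

lemma nn_integral_add_le:
  "(\<integral>\<^sup>+x. f x \<partial>M) + (\<integral>\<^sup>+x. g x \<partial>M) \<le> (\<integral>\<^sup>+x. f x + g x \<partial>M)"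
proof -
  \<comment> \<open>Addition commutes with suprema over nonempty families; the zero function makes
    both families nonempty.\<close>
  have ne: "{h. simple_function M h \<and> h \<le> k} \<noteq> {}" for k :: "'a \<Rightarrow> ennreal"
    by (auto intro!: exI[of _ "\<lambda>_. 0"] simp: le_fun_def)
  have "(\<integral>\<^sup>+x. f x \<partial>M) + (\<integral>\<^sup>+x. g x \<partial>M) =
    (SUP a\<in>{h. simple_function M h \<and> h \<le> f}. SUP b\<in>{h. simple_function M h \<and> h \<le> g}.
       integral\<^sup>S M a + integral\<^sup>S M b)"
    unfolding nn_integral_def ennreal_SUP_add_left[OF ne, symmetric]
    by (subst ennreal_SUP_add_right[OF ne]) (rule refl)
  also have "\<dots> \<le> (\<integral>\<^sup>+x. f x + g x \<partial>M)"
  proof (intro SUP_least, safe)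
    fix a b assume ab: "simple_function M a" "a \<le> f" "simple_function M b" "b \<le> g"
    then have "integral\<^sup>S M a + integral\<^sup>S M b = (\<integral>\<^sup>+x. a x + b x \<partial>M)"
      by (simp add: nn_integral_eq_simple_integral[symmetric] nn_integral_add borel_measurable_simple_function)
    also have "\<dots> \<le> (\<integral>\<^sup>+x. f x + g x \<partial>M)"
      using ab by (intro nn_integral_mono add_mono) (auto simp: le_fun_def)
    finally show "integral\<^sup>S M a + integral\<^sup>S M b \<le> (\<integral>\<^sup>+x. f x + g x \<partial>M)" .
  qed
  finally show ?thesis .
qed

lemma nn_integral_sum_le:
  assumes "finite I"
  shows "(\<Sum>i\<in>I. \<integral>\<^sup>+x. f i x \<partial>M) \<le> (\<integral>\<^sup>+x. (\<Sum>i\<in>I. f i x) \<partial>M)"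
  using assms
proof (induction I rule: finite_induct)
  case (insert i I)
  then have "(\<Sum>i\<in>insert i I. \<integral>\<^sup>+x. f i x \<partial>M) \<le> (\<integral>\<^sup>+x. f i x \<partial>M) + (\<integral>\<^sup>+x. (\<Sum>i\<in>I. f i x) \<partial>M)"
    by (simp add: add_left_mono)
  also have "\<dots> \<le> (\<integral>\<^sup>+x. (\<Sum>i\<in>insert i I. f i x) \<partial>M)"
    using insert nn_integral_add_le[of M "f i"] by simp
  finally show ?case .
qed simp

lemma nn_integral_cmult_le:
  assumes "0 < c"
  shows "(\<integral>\<^sup>+x. ennreal c * f x \<partial>M) \<le> ennreal c * (\<integral>\<^sup>+x. f x \<partial>M)"
  unfolding nn_integral_def[of M "\<lambda>x. ennreal c * f x"]
proof (intro SUP_least, safe)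
  fix a assume a: "simple_function M a" "a \<le> (\<lambda>x. ennreal c * f x)"
  \<comment> \<open>Dividing by the positive finite \<open>c\<close> turns a simple function below
    \<open>c * f\<close> into one below \<open>f\<close>.\<close>
  define b where "b x = ennreal (1 / c) * a x" for x
  have b: "simple_function M b"
    unfolding b_def using a by (intro simple_function_mult) auto
  have scale: "ennreal c * (ennreal (1 / c) * y) = y" "ennreal (1 / c) * (ennreal c * y) = y" for y
  proof -
    have "ennreal c * ennreal (1 / c) = 1"
      using assms by (simp flip: ennreal_mult)
    then show "ennreal c * (ennreal (1 / c) * y) = y" "ennreal (1 / c) * (ennreal c * y) = y"
      by (metis mult.assoc mult.commute mult_1)+
  qed
  have "b x \<le> f x" for x
    unfolding b_def using a(2) scale(2)[of "f x"]
    by (metis le_funD mult_left_mono zero_le)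
  then have "ennreal c * (\<integral>\<^sup>+x. b x \<partial>M) \<le> ennreal c * (\<integral>\<^sup>+x. f x \<partial>M)"
    by (intro mult_left_mono nn_integral_mono) auto
  moreover have "integral\<^sup>S M a = (\<integral>\<^sup>+x. ennreal c * b x \<partial>M)"
    using a by (simp add: nn_integral_eq_simple_integral b_def scale)
  moreover have "\<dots> = ennreal c * (\<integral>\<^sup>+x. b x \<partial>M)"
    using b by (intro nn_integral_cmult borel_measurable_simple_function)
  ultimately show "integral\<^sup>S M a \<le> ennreal c * (\<integral>\<^sup>+x. f x \<partial>M)" by simp
qed

section \<open>Extended powers and deviations of averages\<close>

lemma epowr_ennreal [simp]: "epowr (ennreal x) a = ennreal (max 0 x powr a)"
  by (cases "0 \<le> x") (auto simp: epowr_def ennreal_neg max_def)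

lemma epowr_mono:
  assumes "x \<le> y" "0 \<le> a"
  shows "epowr x a \<le> epowr y a"
proof (cases "y = \<infinity>")
  case False
  then have "x \<noteq> \<infinity>" "enn2real x \<le> enn2real y"
    using assms by (auto simp: top_unique less_top enn2real_mono)
  then show ?thesis
    using False assms by (auto simp: epowr_def intro!: ennreal_leI powr_mono2)
qed (simp add: epowr_def)

lemma le_of_epowr_le:
  assumes "epowr x (1 / q) \<le> ennreal T" "0 < q" "0 \<le> T"
  shows "x \<le> ennreal (T powr q)"
proof (cases "x = \<infinity>")
  case False
  then obtain r where r: "x = ennreal r" "0 \<le> r"
    by (cases x) auto
  then have "r powr (1 / q) \<le> T"
    using assms by (simp add: max_def)
  then have "(r powr (1 / q)) powr q \<le> T powr q"
    using assms by (intro powr_mono2) auto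
  then show ?thesis
    using r assms by (simp add: powr_powr ennreal_leI)
qed (use assms in \<open>simp add: epowr_def top_unique\<close>)

text \<open>The pointwise inequality is integrated after enlarging \<open>A\<close> to
  \<open>B\<close>. Dividing by \<open>measure M A\<close> leaves a ratio of measures, which
  doubling bounds in the applications.\<close>

lemma average_deviation_le:
  assumes sets: "A \<in> sets M" "B \<in> sets M" "A \<subseteq> B"
    and pos: "0 < measure M A" and fin: "emeasure M B < \<infinity>"
    and u: "u \<in> borel_measurable M" "set_integrable M A u"
    and q: "1 \<le> q" and T: "0 \<le> T"
    and le: "(\<integral>\<^sup>+x\<in>B. ennreal (\<bar>u x - a\<bar> powr q) \<partial>M) \<le> ennreal (T powr q * measure M B)"
  shows "\<bar>set_lebesgue_integral M A u / measure M A - a\<bar> \<le> 2 * T * measure M B / measure M A"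
proof -
  have finA: "emeasure M A < \<infinity>"
    using emeasure_mono[OF sets(3,2)] fin by (auto simp: le_less_trans)
  have int_const: "set_integrable M A (\<lambda>_. a)"
    using finA sets unfolding set_integrable_def by (simp add: less_top)
  have diff: "set_integrable M A (\<lambda>x. u x - a)"
    using set_integral_diff(1)[OF u(2) int_const] .
  have emB: "emeasure M B = ennreal (measure M B)"
    using fin by (simp add: emeasure_eq_ennreal_measure less_top)
  have "set_lebesgue_integral M A (\<lambda>x. u x - a) = set_lebesgue_integral M A u - a * measure M A"
    using set_integral_diff(2)[OF u(2) int_const] sets finA by (simp add: set_lebesgue_integral_def)
  then have "(set_lebesgue_integral M A u / measure M A - a) * measure M A = set_lebesgue_integral M A (\<lambda>x. u x - a)"
    using pos by (simp add: left_diff_distrib)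
  then have eq: "\<bar>set_lebesgue_integral M A u / measure M A - a\<bar> * measure M A
      = \<bar>set_lebesgue_integral M A (\<lambda>x. u x - a)\<bar>"
    by (metis abs_mult abs_of_pos pos)
  \<comment> \<open>\<open>T\<close> may vanish, while the pointwise inequality needs a positive
    threshold. So the bound is proved for every \<open>b > T\<close>, and then \<open>b\<close>
    decreases to \<open>T\<close>.\<close>
  have bound: "\<bar>set_lebesgue_integral M A (\<lambda>x. u x - a)\<bar> \<le> 2 * b * measure M B" if b: "T < b" for b
  proof -
    have "0 < b" using T b by simp
    have "ennreal \<bar>set_lebesgue_integral M A (\<lambda>x. u x - a)\<bar>
        \<le> (\<integral>\<^sup>+x. ennreal \<bar>indicator A x * (u x - a)\<bar> \<partial>M)"
      using integral_norm_bound_ennreal[OF diff[unfolded set_integrable_def]]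
      by (simp add: set_lebesgue_integral_def)
    also have "\<dots> \<le> (\<integral>\<^sup>+x. ennreal b * indicator B x
         + ennreal (b powr (1 - q)) * (ennreal (\<bar>u x - a\<bar> powr q) * indicator B x) \<partial>M)"
    proof (intro nn_integral_mono)
      fix x
      have "ennreal \<bar>u x - a\<bar> \<le> ennreal (b + \<bar>u x - a\<bar> powr q * b powr (1 - q))"
        using \<open>0 < b\<close> q by (intro ennreal_leI le_add_powr_mult_powr) auto
      then show "ennreal \<bar>indicator A x * (u x - a)\<bar> \<le> ennreal b * indicator B x
         + ennreal (b powr (1 - q)) * (ennreal (\<bar>u x - a\<bar> powr q) * indicator B x)"
        using sets \<open>0 < b\<close>
        by (auto simp: indicator_def ennreal_mult'[symmetric] mult.commute simp flip: ennreal_plus)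
    qed
    also have "\<dots> = ennreal b * emeasure M B
         + ennreal (b powr (1 - q)) * (\<integral>\<^sup>+x\<in>B. ennreal (\<bar>u x - a\<bar> powr q) \<partial>M)"
      using sets u by (subst nn_integral_add) (auto simp: nn_integral_cmult)
    also have "\<dots> \<le> ennreal b * ennreal (measure M B) + ennreal (b powr (1 - q)) * ennreal (T powr q * measure M B)"
      using emB le by (intro add_mono mult_left_mono) auto
    also have "\<dots> = ennreal (b * measure M B + b powr (1 - q) * (T powr q * measure M B))"
      using \<open>0 < b\<close> by (subst ennreal_plus) (auto simp: ennreal_mult)
    finally have "\<bar>set_lebesgue_integral M A (\<lambda>x. u x - a)\<bar>
        \<le> b * measure M B + b powr (1 - q) * (T powr q * measure M B)"
      using \<open>0 < b\<close> by (simp add: ennreal_le_iff del: ennreal_plus)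
    also have "\<dots> \<le> b * measure M B + b powr (1 - q) * (b powr q * measure M B)"
      using b T q by (intro add_left_mono mult_left_mono mult_right_mono powr_mono2) auto
    also have "b powr (1 - q) * (b powr q * measure M B) = b powr ((1 - q) + q) * measure M B"
      unfolding powr_add by (rule mult.assoc[symmetric])
    also have "b powr ((1 - q) + q) = b"
      using \<open>0 < b\<close> by simp
    finally show ?thesis by simp
  qed
  have "\<bar>set_lebesgue_integral M A (\<lambda>x. u x - a)\<bar> \<le> 2 * T * measure M B"
  proof (rule tendsto_lowerbound[where F = "at_right T" and f = "\<lambda>b. 2 * b * measure M B"])
    show "((\<lambda>b. 2 * b * measure M B) \<longlongrightarrow> 2 * T * measure M B) (at_right T)"
      by (intro tendsto_intros)
    show "\<forall>\<^sub>F b in at_right T. \<bar>set_lebesgue_integral M A (\<lambda>x. u x - a)\<bar> \<le> 2 * b * measure M B"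
      using eventually_at_right_less[of T] by eventually_elim (rule bound)
  qed simp
  then show ?thesis
    using eq pos by (simp add: field_simps)
qed

lemma ball_subset_ballI:
  fixes x y :: "'a::metric_space"
  assumes "dist x y + r \<le> s"
  shows "ball x r \<subseteq> ball y s"
proof
  fix z assume "z \<in> ball x r"
  then show "z \<in> ball y s"
    using assms dist_triangle[of y z x] by (simp add: dist_commute)
qed

section \<open>Doubling measures\<close>

text \<open>The doubling constant is fixed, so that every later comparison of two balls costs an
  explicit power of \<open>c\<close>.\<close>

locale doubling_space =
  fixes \<mu> :: "'a::metric_space measure" and c :: real
  assumes sets_eq_borel: "sets \<mu> = sets borel"
    and emeasure_ball_pos: "0 < r \<Longrightarrow> 0 < emeasure \<mu> (ball x r)"
    and emeasure_ball_finite: "0 < r \<Longrightarrow> emeasure \<mu> (ball x r) < \<infinity>"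
    and one_le_c: "1 \<le> c"
    and doubling: "0 < r \<Longrightarrow> measure \<mu> (ball x (2 * r)) \<le> c * measure \<mu> (ball x r)"
begin

lemma ball_in_sets [simp]: "ball x r \<in> sets \<mu>"
  by (simp add: sets_eq_borel)

lemma ball_fmeasurable [simp]: "ball x r \<in> fmeasurable \<mu>"
  using emeasure_ball_finite[of r x] by (cases "0 < r") (auto simp: fmeasurable_def ball_empty)

lemma measure_ball_pos: "0 < r \<Longrightarrow> 0 < measure \<mu> (ball x r)"
  using emeasure_ball_pos[of r x] emeasure_ball_finite[of r x]
  by (simp add: measure_def enn2real_positive_iff)

lemma emeasure_ball: "emeasure \<mu> (ball x r) = ennreal (measure \<mu> (ball x r))"
  by (rule emeasure_eq_measure2) simp

lemma measure_ball_power2_le: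
  assumes "0 < r"
  shows "measure \<mu> (ball x (2 ^ k * r)) \<le> c ^ k * measure \<mu> (ball x r)"
proof (induction k)
  case (Suc k)
  have "measure \<mu> (ball x (2 ^ Suc k * r)) \<le> c * measure \<mu> (ball x (2 ^ k * r))"
    using doubling[of "2 ^ k * r" x] assms by (simp add: mult.assoc)
  also have "\<dots> \<le> c * (c ^ k * measure \<mu> (ball x r))"
    using Suc one_le_c by (intro mult_left_mono) auto
  finally show ?case by (simp add: mult.assoc)
qed simp

lemma measure_le_ball:
  assumes "0 < r" "A \<in> sets \<mu>" "A \<subseteq> ball x (2 ^ k * r)"
  shows "measure \<mu> A \<le> c ^ k * measure \<mu> (ball x r)"
  using measure_mono_fmeasurable[OF assms(3,2)] measure_ball_power2_le[OF assms(1), of x k]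
  by (meson ball_fmeasurable order_trans)

text \<open>Volume comparison: \<open>ball z (L + r)\<close> contains all the disjoint balls, and
  the \<open>2 ^ k\<close>-fold enlargement of each of them contains it, since the centres are
  within \<open>L\<close> of \<open>z\<close>. Each ball thus carries at least the fraction
  \<open>1 / c ^ k\<close> of its measure.\<close>

lemma packing_card_le:
  fixes S :: "'a set"
  assumes "finite S" "0 < r" "0 \<le> L" "S \<subseteq> cball z L" "disjoint_family_on (\<lambda>x. ball x r) S"
    and k: "2 * L + r \<le> 2 ^ k * r"
  shows "real (card S) \<le> c ^ k"
proof -
  define V where "V = measure \<mu> (ball z (L + r))"
  have V: "0 < V"
    unfolding V_def using assms by (intro measure_ball_pos) auto
  have "V \<le> c ^ k * measure \<mu> (ball x r)" if "x \<in> S" for x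
  proof -
    have "dist z x \<le> L"
      using that assms by (auto simp: dist_commute)
    then have "ball z (L + r) \<subseteq> ball x (2 ^ k * r)"
      using k by (intro ball_subset_ballI) (auto simp: dist_commute)
    then show ?thesis
      unfolding V_def using assms by (intro measure_le_ball) auto
  qed
  then have "card S * V \<le> (\<Sum>x\<in>S. c ^ k * measure \<mu> (ball x r))"
    using sum_mono[of S "\<lambda>_. V" "\<lambda>x. c ^ k * measure \<mu> (ball x r)"] by simp
  also have "\<dots> = c ^ k * measure \<mu> (\<Union>x\<in>S. ball x r)"
    using assms(1,5) by (subst measure_UNION')
      (auto simp: sum_distrib_left pairwise_def disjnt_def disjoint_family_on_def)
  also have "\<dots> \<le> c ^ k * V"
  proof -
    have "(\<Union>x\<in>S. ball x r) \<subseteq> ball z (L + r)"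
      using assms(4) by (intro UN_least ball_subset_ballI) (auto simp: dist_commute)
    then show ?thesis
      unfolding V_def using one_le_c
      by (intro mult_left_mono measure_mono_fmeasurable) (auto simp: sets_eq_borel intro!: borel_open)
  qed
  finally show ?thesis
    using V by simp
qed

text \<open>Packing bounds the cardinality of \<open>2 * r\<close>-separated subsets of
  \<open>A\<close>, so one of largest cardinality exists; a point of \<open>A\<close> far from all
  of it could be added to it.\<close>

lemma maximal_separated_set_exists:
  fixes A :: "'a set"
  assumes "A \<subseteq> cball z L" "0 < r"
  obtains S where "finite S" "S \<subseteq> A" "disjoint_family_on (\<lambda>x. ball x r) S"
    "\<And>a. a \<in> A \<Longrightarrow> \<exists>x\<in>S. dist a x < 2 * r"
proof -
  define P where "P S \<longleftrightarrow> finite S \<and> S \<subseteq> A \<and> (\<forall>x\<in>S. \<forall>y\<in>S. x \<noteq> y \<longrightarrow> 2 * r \<le> dist x y)" for S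
  have P_disj: "disjoint_family_on (\<lambda>x. ball x r) S" if "P S" for S
    unfolding disjoint_family_on_def
  proof (intro ballI impI)
    fix x y assume "x \<in> S" "y \<in> S" "x \<noteq> y"
    with that have far: "2 * r \<le> dist x y" by (auto simp: P_def)
    have False if "z \<in> ball x r" "z \<in> ball y r" for z
      using that far dist_triangle2[of x y z] by simp
    then show "ball x r \<inter> ball y r = {}" by auto
  qed
  \<comment> \<open>\<open>L\<close> may be negative, with \<open>cball z L\<close> empty, whereas
    the packing bound asks for a nonnegative radius; hence \<open>max 0 L\<close>.\<close>
  obtain k where k: "(2 * max 0 L + r) / r < 2 ^ k"
    using real_arch_pow[of 2] by auto
  have card: "card S \<le> nat \<lfloor>c ^ k\<rfloor>" if "P S" for S
  proof -
    have "real (card S) \<le> c ^ k"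
    proof (rule packing_card_le)
      show "S \<subseteq> cball z (max 0 L)"
        using that assms by (auto simp: P_def)
      show "2 * max 0 L + r \<le> 2 ^ k * r"
        using k assms by (simp add: field_simps)
    qed (use that P_disj assms in \<open>auto simp: P_def\<close>)
    then show ?thesis by linarith
  qed
  have "P {}" by (simp add: P_def)
  then obtain S where S: "P S" "\<And>T. P T \<Longrightarrow> card T \<le> card S"
    using ex_has_greatest_nat[of P "{}" card "Suc (nat \<lfloor>c ^ k\<rfloor>)"] card
    by (auto simp: less_Suc_eq_le)
  have "\<exists>x\<in>S. dist a x < 2 * r" if a: "a \<in> A" for a
  proof (rule ccontr)
    assume contra: "\<not> (\<exists>x\<in>S. dist a x < 2 * r)"
    then have "a \<notin> S" using assms by (metis dist_self mult_pos_pos zero_less_numeral)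
    have "P (insert a S)"
      using S(1) a contra unfolding P_def by (auto simp: not_less dist_commute)
    with S(2) have "card (insert a S) \<le> card S" by blast
    with \<open>a \<notin> S\<close> S(1) show False by (simp add: P_def)
  qed
  with that[of S] S(1) P_disj[OF S(1)] show thesis by (auto simp: P_def)
qed

text \<open>Maximal separated sets are finite nets, so closed balls are totally bounded. Compactness
  gives the boundedness and uniform continuity of \<open>u\<close> on balls.\<close>

lemma compact_cball:
  fixes z :: 'a
  assumes "complete (UNIV :: 'a set)"
  shows "compact (cball z L)"
  unfolding compact_eq_totally_bounded
proof (intro conjI allI impI)
  show "complete (cball z L)"
    using complete_Int_closed[OF assms, of "cball z L"] by simp
  fix e :: real assume "0 < e"
  obtain S where "finite S" "\<And>a. a \<in> cball z L \<Longrightarrow> \<exists>x\<in>S. dist a x < 2 * (e / 2)"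
    by (rule maximal_separated_set_exists[of "cball z L" z L "e / 2"]) (use \<open>0 < e\<close> in auto)
  then show "\<exists>k. finite k \<and> cball z L \<subseteq> (\<Union>x\<in>k. ball x e)"
    by (intro exI[of _ S]) (force simp: dist_commute)
qed

text \<open>The centres counted all lie within \<open>\<Lambda> * r\<close> of \<open>y\<close>, so
  packing applies; the bound does not depend on \<open>r\<close>.\<close>

lemma overlap_card_le:
  fixes S :: "'a set"
  assumes "finite S" "0 < r" "1 \<le> \<Lambda>" "disjoint_family_on (\<lambda>x. ball x r) S"
    and k: "2 * \<Lambda> + 1 \<le> 2 ^ k"
  shows "real (card {x \<in> S. y \<in> ball x (\<Lambda> * r)}) \<le> c ^ k"
proof (rule packing_card_le[of _ r "\<Lambda> * r" y])
  show "2 * (\<Lambda> * r) + r \<le> 2 ^ k * r"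
    using mult_right_mono[OF k, of r] assms by (simp add: algebra_simps)
qed (use assms in \<open>auto simp: dist_commute intro: disjoint_family_on_mono[rotated]\<close>)

text \<open>The children form a maximal separated subset of \<open>E\<close> near \<open>x\<close>.
  Their fourfold enlargements cover the neighbourhood of \<open>E\<close> in
  \<open>ball x (r / 2)\<close>, which costs \<open>c ^ 2\<close>; passing from \<open>r / 2\<close>
  to \<open>r\<close> costs another \<open>c\<close>. The radius \<open>3 / 4 * r\<close> keeps the
  balls of the children inside \<open>ball x r\<close>.\<close>

lemma children_exist:
  assumes "x \<in> E" "0 < r" "0 < \<epsilon>" "\<epsilon> \<le> 1 / 4"
    and thick: "\<theta> * measure \<mu> (ball x (r / 2)) \<le> measure \<mu> ({y. infdist y E < \<epsilon> * r} \<inter> ball x (r / 2))"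
    and "0 \<le> \<theta>"
  obtains S where "finite S" "S \<subseteq> E \<inter> ball x (3 / 4 * r)" "disjoint_family_on (\<lambda>y. ball y (\<epsilon> * r)) S"
    "\<theta> / c ^ 3 * measure \<mu> (ball x r) \<le> (\<Sum>y\<in>S. measure \<mu> (ball y (\<epsilon> * r)))"
proof -
  have \<epsilon>r: "\<epsilon> * r \<le> r / 4" "0 < \<epsilon> * r"
    using assms mult_right_mono[of \<epsilon> "1 / 4" r] by auto
  have sub: "E \<inter> ball x (3 / 4 * r) \<subseteq> cball x (3 / 4 * r)"
    by auto
  obtain S where S: "finite S" "S \<subseteq> E \<inter> ball x (3 / 4 * r)" "disjoint_family_on (\<lambda>y. ball y (\<epsilon> * r)) S"
    and max: "\<And>a. a \<in> E \<inter> ball x (3 / 4 * r) \<Longrightarrow> \<exists>y\<in>S. dist a y < 2 * (\<epsilon> * r)"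
    by (rule maximal_separated_set_exists[OF sub \<epsilon>r(2)]) blast
  let ?s = "\<Sum>y\<in>S. measure \<mu> (ball y (\<epsilon> * r))"
  let ?U = "{y. infdist y E < \<epsilon> * r} \<inter> ball x (r / 2)"
  have "open {y. infdist y E < \<epsilon> * r}"
    by (intro open_Collect_less continuous_intros)
  then have U: "?U \<in> sets \<mu>"
    by (simp add: sets_eq_borel)
  \<comment> \<open>Such a \<open>y\<close> is within \<open>\<epsilon> * r\<close> of some
    \<open>a\<close> in \<open>E\<close>, and \<open>a\<close> is within
    \<open>2 * (\<epsilon> * r)\<close> of a chosen point; the total is below
    \<open>4 * (\<epsilon> * r)\<close>.\<close>
  have cover: "?U \<subseteq> (\<Union>y\<in>S. ball y (2 ^ 2 * (\<epsilon> * r)))"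
  proof
    fix y assume y: "y \<in> ?U"
    have "E \<noteq> {}" using assms by auto
    then obtain a where a: "a \<in> E" "dist y a < \<epsilon> * r"
      using y by (auto simp: infdist_def cINF_less_iff)
    have "dist x a < 3 / 4 * r"
      using y a \<epsilon>r dist_triangle[of x a y] by auto
    then obtain b where "b \<in> S" "dist a b < 2 * (\<epsilon> * r)"
      using max a by auto
    then show "y \<in> (\<Union>y\<in>S. ball y (2 ^ 2 * (\<epsilon> * r)))"
      using a \<epsilon>r dist_triangle[of y b a] by (auto intro!: bexI[of _ b] simp: dist_commute)
  qed
  have "measure \<mu> ?U \<le> measure \<mu> (\<Union>y\<in>S. ball y (2 ^ 2 * (\<epsilon> * r)))"
    using U S(1) by (intro measure_mono_fmeasurable[OF cover] fmeasurable.finite_UN) auto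
  also have "\<dots> \<le> (\<Sum>y\<in>S. measure \<mu> (ball y (2 ^ 2 * (\<epsilon> * r))))"
    using S(1) by (intro measure_UNION_le) auto
  also have "\<dots> \<le> (\<Sum>y\<in>S. c ^ 2 * measure \<mu> (ball y (\<epsilon> * r)))"
    using \<epsilon>r by (intro sum_mono measure_ball_power2_le)
  also have "\<dots> = c ^ 2 * ?s"
    by (simp only: sum_distrib_left)
  finally have U_le: "measure \<mu> ?U \<le> c ^ 2 * ?s" .
  have "\<theta> * measure \<mu> (ball x r) \<le> \<theta> * (c * measure \<mu> (ball x (r / 2)))"
    using doubling[of "r / 2" x] assms by (intro mult_left_mono) auto
  also have "\<dots> = c * (\<theta> * measure \<mu> (ball x (r / 2)))"
    by (rule mult.left_commute)
  also have "\<dots> \<le> c * (c ^ 2 * ?s)"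
    using order_trans[OF thick U_le] one_le_c by (intro mult_left_mono) auto
  also have "\<dots> = c ^ 3 * ?s"
    by (simp add: power2_eq_square power3_eq_cube)
  finally have "\<theta> / c ^ 3 * measure \<mu> (ball x r) \<le> ?s"
    using one_le_c by (simp add: pos_divide_le_eq mult.commute)
  with S that show thesis by blast
qed

end

section \<open>Branching sets\<close>

text \<open>The ball of the theorem is \<open>ball w R\<close>. From one generation to the next
  radii shrink by \<open>\<epsilon>\<close>, and the children of a ball keep at least the fraction
  \<open>\<delta>\<close> of its measure; \<open>\<Lambda>\<close> is the dilation in the Poincare
  inequality.\<close>

locale branching_set = doubling_space \<mu> c
  for \<mu> :: "'a::metric_space measure" and c +
  fixes E :: "'a set" and \<epsilon> \<delta> \<Lambda> R :: real and w :: 'a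
  assumes \<epsilon>: "0 < \<epsilon>" "\<epsilon> \<le> 1 / 4"
    and \<delta>: "0 < \<delta>"
    and \<Lambda>: "1 \<le> \<Lambda>"
    and R: "0 < R"
    and w: "w \<in> E"
    and children: "\<lbrakk>x \<in> E; 0 < r; r \<le> R\<rbrakk> \<Longrightarrow> \<exists>S. finite S \<and> S \<subseteq> E \<inter> ball x (3 / 4 * r) \<and>
      disjoint_family_on (\<lambda>y. ball y (\<epsilon> * r)) S \<and>
      \<delta> * measure \<mu> (ball x r) \<le> (\<Sum>y\<in>S. measure \<mu> (ball y (\<epsilon> * r)))"
begin

text \<open>\<open>F\<close> holds the centres of one level of the tree and \<open>W\<close> a
  probability distribution on them. The distance condition keeps every dilated ball inside
  \<open>ball w (\<Lambda> * R)\<close>. The upper bound on the weights is multiplied out to avoid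
  division.\<close>

definition generation :: "nat \<Rightarrow> 'a set \<Rightarrow> ('a \<Rightarrow> real) \<Rightarrow> bool" where
  "generation n F W \<longleftrightarrow>
     finite F \<and> F \<subseteq> E \<and> disjoint_family_on (\<lambda>x. ball x (\<epsilon> ^ n * R)) F \<and>
     (\<forall>x\<in>F. dist x w + \<Lambda> * (\<epsilon> ^ n * R) \<le> \<Lambda> * R) \<and>
     (\<forall>x\<in>F. 0 \<le> W x \<and> W x * \<delta> ^ n * measure \<mu> (ball w R) \<le> measure \<mu> (ball x (\<epsilon> ^ n * R))) \<and>
     sum W F = 1"

lemma generation_0: "generation 0 {w} (\<lambda>_. 1)"
  using w by (simp add: generation_def disjoint_family_on_def)

lemma radius_pos: "0 < \<epsilon> ^ n * R"
  using \<epsilon> R by simp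

lemma radius_le: "\<epsilon> ^ n * R \<le> R"
  using \<epsilon> R by (simp add: power_le_one mult_left_le_one_le)

text \<open>Every point hands its weight to its children in proportion to the measures of their
  balls. The parent relation is not recorded in \<open>generation\<close>; the second conclusion is
  the form in which later arguments use it.\<close>

lemma generation_Suc:
  assumes gen: "generation n F W"
  obtains F' W' where "generation (Suc n) F' W'"
    "\<And>f g T. (\<And>x y. \<lbrakk>x \<in> F; y \<in> E; y \<in> ball x (3 / 4 * (\<epsilon> ^ n * R))\<rbrakk> \<Longrightarrow> g x \<le> f y + T x) \<Longrightarrow>
       (\<Sum>x\<in>F. W x * g x) \<le> (\<Sum>x\<in>F. W x * T x) + (\<Sum>y\<in>F'. W' y * f y :: real)"
proof -
  define \<rho> where "\<rho> = \<epsilon> ^ n * R"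
  have \<rho>: "0 < \<rho>" "\<rho> \<le> R"
    unfolding \<rho>_def by (rule radius_pos radius_le)+
  have \<epsilon>\<rho>: "\<epsilon> * \<rho> \<le> \<rho> / 4" "0 < \<epsilon> * \<rho>"
    using \<epsilon> \<rho> mult_right_mono[of \<epsilon> "1 / 4" \<rho>] by auto
  have F: "finite F" "F \<subseteq> E" "disjoint_family_on (\<lambda>x. ball x \<rho>) F" "sum W F = 1"
    and inside: "\<And>x. x \<in> F \<Longrightarrow> dist x w + \<Lambda> * \<rho> \<le> \<Lambda> * R"
    and W: "\<And>x. x \<in> F \<Longrightarrow> 0 \<le> W x" "\<And>x. x \<in> F \<Longrightarrow> W x * \<delta> ^ n * measure \<mu> (ball w R) \<le> measure \<mu> (ball x \<rho>)"
    using gen unfolding generation_def \<rho>_def by auto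
  have "\<forall>x\<in>F. \<exists>S. finite S \<and> S \<subseteq> E \<inter> ball x (3 / 4 * \<rho>) \<and>
      disjoint_family_on (\<lambda>y. ball y (\<epsilon> * \<rho>)) S \<and>
      \<delta> * measure \<mu> (ball x \<rho>) \<le> (\<Sum>y\<in>S. measure \<mu> (ball y (\<epsilon> * \<rho>)))"
    using F(2) \<rho> by (intro ballI children) auto
  then obtain S where S: "\<And>x. x \<in> F \<Longrightarrow> finite (S x)" "\<And>x. x \<in> F \<Longrightarrow> S x \<subseteq> E \<inter> ball x (3 / 4 * \<rho>)"
      "\<And>x. x \<in> F \<Longrightarrow> disjoint_family_on (\<lambda>y. ball y (\<epsilon> * \<rho>)) (S x)"
      "\<And>x. x \<in> F \<Longrightarrow> \<delta> * measure \<mu> (ball x \<rho>) \<le> (\<Sum>y\<in>S x. measure \<mu> (ball y (\<epsilon> * \<rho>)))"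
    unfolding Bex_def by (metis bchoice)
  define \<nu> where "\<nu> y = measure \<mu> (ball y (\<epsilon> * \<rho>))" for y
  define \<sigma> where "\<sigma> x = (\<Sum>y\<in>S x. \<nu> y)" for x
  have \<nu>: "0 < \<nu> y" for y
    unfolding \<nu>_def by (intro measure_ball_pos \<epsilon>\<rho>)
  have \<sigma>_ge: "\<delta> * measure \<mu> (ball x \<rho>) \<le> \<sigma> x" if "x \<in> F" for x
    using S(4)[OF that] by (simp add: \<sigma>_def \<nu>_def)
  have \<sigma>: "0 < \<sigma> x" if "x \<in> F" for x
    using \<sigma>_ge[OF that] \<delta> measure_ball_pos[OF \<rho>(1), of x] by (smt (verit) mult_pos_pos)
  have sub: "ball y (\<epsilon> * \<rho>) \<subseteq> ball x \<rho>" if "x \<in> F" "y \<in> S x" for x y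
    using S(2)[OF that(1)] that \<epsilon>\<rho> by (intro ball_subset_ballI) (auto simp: dist_commute)
  have unique: "x = x'" if "x \<in> F" "x' \<in> F" "z \<in> ball x \<rho>" "z \<in> ball x' \<rho>" for x x' z
    using F(3) that unfolding disjoint_family_on_def by blast
  have unique': "x = x'" if "x \<in> F" "x' \<in> F" "y \<in> S x" "y \<in> S x'" for x x' y
  proof -
    have "y \<in> ball y (\<epsilon> * \<rho>)" using \<epsilon>\<rho> by simp
    then show ?thesis
      using sub[OF that(1,3)] sub[OF that(2,4)] by (intro unique[OF that(1,2)]) blast+
  qed
  \<comment> \<open>Unique, because the ball of a child lies in the ball of its parent, and distinct
    parents have disjoint balls.\<close>
  define par where "par y = (THE x. x \<in> F \<and> y \<in> S x)" for y
  have par: "par y = x" if "x \<in> F" "y \<in> S x" for x y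
    unfolding par_def using that unique' by blast
  define F' where "F' = (\<Union>x\<in>F. S x)"
  define W' where "W' y = W (par y) * \<nu> y / \<sigma> (par y)" for y
  have sum_F': "(\<Sum>y\<in>F'. W' y * h y) = (\<Sum>x\<in>F. W x * (\<Sum>y\<in>S x. \<nu> y / \<sigma> x * h y))" for h
  proof -
    have "(\<Sum>y\<in>F'. W' y * h y) = (\<Sum>x\<in>F. \<Sum>y\<in>S x. W' y * h y)"
      unfolding F'_def using F(1) S(1) unique' by (intro sum.UNION_disjoint) blast+
    also have "\<dots> = (\<Sum>x\<in>F. W x * (\<Sum>y\<in>S x. \<nu> y / \<sigma> x * h y))"
      by (simp add: sum_distrib_left W'_def par mult.assoc cong: sum.cong)
    finally show ?thesis .
  qed
  have sum_1: "(\<Sum>y\<in>S x. \<nu> y / \<sigma> x) = 1" if "x \<in> F" for x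
    using \<sigma>[OF that] by (simp add: sum_divide_distrib[symmetric] \<sigma>_def[symmetric])
  have \<rho>_Suc: "\<epsilon> ^ Suc n * R = \<epsilon> * \<rho>"
    by (simp add: \<rho>_def)
  have "generation (Suc n) F' W'"
    unfolding generation_def \<rho>_Suc
  proof (intro conjI ballI)
    show "finite F'" "F' \<subseteq> E"
      using F S by (auto simp: F'_def)
    show "disjoint_family_on (\<lambda>x. ball x (\<epsilon> * \<rho>)) F'"
      unfolding disjoint_family_on_def
    proof (intro ballI impI)
      fix y y' assume "y \<in> F'" "y' \<in> F'" "y \<noteq> y'"
      then obtain x x' where x: "x \<in> F" "y \<in> S x" "x' \<in> F" "y' \<in> S x'"
        by (auto simp: F'_def)
      show "ball y (\<epsilon> * \<rho>) \<inter> ball y' (\<epsilon> * \<rho>) = {}"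
      proof (cases "x = x'")
        case True
        then show ?thesis
          using S(3)[of x] x \<open>y \<noteq> y'\<close> by (auto simp: disjoint_family_on_def)
      next
        case False
        then show ?thesis
          using sub[OF x(1,2)] sub[OF x(3,4)] unique[OF x(1,3)] by blast
      qed
    qed
    show "sum W' F' = 1"
      using sum_F'[of "\<lambda>_. 1"] sum_1 F(4) by (simp cong: sum.cong)
    fix y assume "y \<in> F'"
    then obtain x where x: "x \<in> F" "y \<in> S x"
      by (auto simp: F'_def)
    have W'_y: "W' y = W x * \<nu> y / \<sigma> x"
      using par[OF x] by (simp add: W'_def)
    show "0 \<le> W' y"
      unfolding W'_y using W(1)[OF x(1)] \<nu>[of y] \<sigma>[OF x(1)] by (simp add: less_imp_le)
    \<comment> \<open>The child moves by at most \<open>3 / 4 * \<rho>\<close> and its dilated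
      radius is at most \<open>\<Lambda> * \<rho> / 4\<close>; since \<open>\<Lambda> >= 1\<close>,
      both fit into the \<open>\<Lambda> * \<rho>\<close> of the parent.\<close>
    have "dist y w \<le> 3 / 4 * \<rho> + dist x w"
      using S(2)[OF x(1)] x(2) dist_triangle[of y w x] by (auto simp: dist_commute)
    moreover have "\<Lambda> * (\<epsilon> * \<rho>) \<le> \<Lambda> * (\<rho> / 4)"
      using \<epsilon>\<rho> \<Lambda> by (intro mult_left_mono) auto
    moreover have "\<rho> \<le> \<Lambda> * \<rho>"
      using \<Lambda> \<rho> by simp
    ultimately show "dist y w + \<Lambda> * (\<epsilon> * \<rho>) \<le> \<Lambda> * R"
      using inside[OF x(1)] by (simp add: algebra_simps)
    \<comment> \<open>The additional factor \<open>\<delta>\<close> replaces the measure of the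
      parent's ball by the total measure of the children; multiplying by the share
      \<open>\<nu> y / \<sigma> x\<close> then leaves \<open>\<nu> y\<close>.\<close>
    have "W x * \<delta> ^ Suc n * measure \<mu> (ball w R) \<le> \<sigma> x"
      using order_trans[OF mult_left_mono[OF W(2)[OF x(1)], of \<delta>] \<sigma>_ge[OF x(1)]] \<delta>
      by (simp add: mult_ac)
    then have "W x * \<delta> ^ Suc n * measure \<mu> (ball w R) * (\<nu> y / \<sigma> x) \<le> \<sigma> x * (\<nu> y / \<sigma> x)"
      using \<nu>[of y] \<sigma>[OF x(1)] by (intro mult_right_mono) auto
    then show "W' y * \<delta> ^ Suc n * measure \<mu> (ball w R) \<le> measure \<mu> (ball y (\<epsilon> * \<rho>))"
      using \<sigma>[OF x(1)] unfolding W'_y \<nu>_def[symmetric] by (simp add: mult_ac)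
  qed
  moreover have "(\<Sum>x\<in>F. W x * g x) \<le> (\<Sum>x\<in>F. W x * T x) + (\<Sum>y\<in>F'. W' y * f y)"
    if le: "\<And>x y. \<lbrakk>x \<in> F; y \<in> E; y \<in> ball x (3 / 4 * (\<epsilon> ^ n * R))\<rbrakk> \<Longrightarrow> g x \<le> f y + T x"
    for f g T :: "'a \<Rightarrow> real"
  proof -
    \<comment> \<open>The shares of the children of \<open>x\<close> sum to one, so
      \<open>g x\<close> is their average of \<open>g x\<close> and can be compared child by
      child.\<close>
    have "W x * g x \<le> W x * T x + W x * (\<Sum>y\<in>S x. \<nu> y / \<sigma> x * f y)" if x: "x \<in> F" for x
    proof -
      have sum_const: "(\<Sum>y\<in>S x. \<nu> y / \<sigma> x * b) = b" for b
        unfolding sum_distrib_right[symmetric] sum_1[OF x] by simp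
      have "g x = (\<Sum>y\<in>S x. \<nu> y / \<sigma> x * g x)"
        by (rule sum_const[symmetric])
      also have "\<dots> \<le> (\<Sum>y\<in>S x. \<nu> y / \<sigma> x * (f y + T x))"
        using S(2)[OF x] x \<nu> \<sigma>[OF x]
        by (intro sum_mono mult_left_mono le) (auto simp: \<rho>_def less_imp_le)
      also have "\<dots> = T x + (\<Sum>y\<in>S x. \<nu> y / \<sigma> x * f y)"
        unfolding distrib_left sum.distrib sum_const by (rule add.commute)
      finally show ?thesis
        using W(1)[OF x] by (simp add: mult_left_mono flip: distrib_left)
    qed
    then show ?thesis
      unfolding sum_F' by (simp add: sum_mono flip: sum.distrib)
  qed
  ultimately show thesis
    by (rule that)
qed

text \<open>Iterates the averaging step of \<open>generation_Suc\<close>. The error \<open>T\<close>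
  is controlled only in weighted mean over a generation. The tree is built during the induction, so
  that control is assumed for all generations.\<close>

lemma telescoping_le:
  assumes step: "\<And>x y r. \<lbrakk>x \<in> E; y \<in> E; 0 < r; dist x w + \<Lambda> * r \<le> \<Lambda> * R; y \<in> ball x (3 / 4 * r)\<rbrakk>
      \<Longrightarrow> f x r \<le> f y (\<epsilon> * r) + T x r"
    and T: "\<And>n F W. generation n F W \<Longrightarrow> (\<Sum>x\<in>F. W x * T x (\<epsilon> ^ n * R)) \<le> \<tau> n"
  shows "\<exists>F W. generation n F W \<and> f w R \<le> (\<Sum>i<n. \<tau> i) + (\<Sum>x\<in>F. W x * f x (\<epsilon> ^ n * R) :: real)"
proof (induction n)
  case 0
  show ?case
    using generation_0 by (intro exI[of _ "{w}"] exI[of _ "\<lambda>_. 1"]) auto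
next
  case (Suc n)
  then obtain F W where gen: "generation n F W"
    and le: "f w R \<le> (\<Sum>i<n. \<tau> i) + (\<Sum>x\<in>F. W x * f x (\<epsilon> ^ n * R))"
    by blast
  obtain F' W' where gen': "generation (Suc n) F' W'"
    and sum_le: "\<And>f g T. (\<And>x y. \<lbrakk>x \<in> F; y \<in> E; y \<in> ball x (3 / 4 * (\<epsilon> ^ n * R))\<rbrakk> \<Longrightarrow> g x \<le> f y + T x) \<Longrightarrow>
       (\<Sum>x\<in>F. W x * g x) \<le> (\<Sum>x\<in>F. W x * T x) + (\<Sum>y\<in>F'. W' y * f y :: real)"
    by (rule generation_Suc[OF gen]) blast
  have "(\<Sum>x\<in>F. W x * f x (\<epsilon> ^ n * R))
      \<le> (\<Sum>x\<in>F. W x * T x (\<epsilon> ^ n * R)) + (\<Sum>y\<in>F'. W' y * f y (\<epsilon> * (\<epsilon> ^ n * R)))"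
    using gen radius_pos unfolding generation_def by (intro sum_le step) auto
  with le T[OF gen] have "f w R \<le> (\<Sum>i<Suc n. \<tau> i) + (\<Sum>y\<in>F'. W' y * f y (\<epsilon> ^ Suc n * R))"
    by (simp add: mult.assoc)
  with gen' show ?case by blast
qed

end

section \<open>Fractional energies and averages\<close>

context doubling_space
begin

lemma frac_energy_mono:
  assumes "A \<subseteq> B" "0 < p" "0 < t"
  shows "frac_energy \<mu> s p t A u \<le> frac_energy \<mu> s p t B u"
  unfolding frac_energy_def using assms
  by (intro nn_integral_mono mult_mono epowr_mono) (auto simp: indicator_def)

text \<open>Enlarging the inner integral to \<open>A\<close> makes the integrand independent of the
  ball; what remains is the sum of the indicators, bounded by the overlap. Only superadditivity of
  the integral is used.\<close>

lemma sum_frac_energy_le: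
  assumes F: "finite F" "disjoint_family_on (\<lambda>x. ball x r) F" and r: "0 < r"
    and \<Lambda>: "1 \<le> \<Lambda>" "2 * \<Lambda> + 1 \<le> 2 ^ k"
    and sub: "\<And>x. x \<in> F \<Longrightarrow> ball x (\<Lambda> * r) \<subseteq> A"
    and pt: "0 < p" "0 < t"
  shows "(\<Sum>x\<in>F. frac_energy \<mu> s p t (ball x (\<Lambda> * r)) u) \<le> ennreal (c ^ k) * frac_energy \<mu> s p t A u"
proof -
  define f where "f x = epowr (\<integral>\<^sup>+y\<in>A. ennreal (\<bar>u x - u y\<bar> powr t /
      (dist x y powr (s * t) * measure \<mu> (ball x (dist x y)))) \<partial>(completion \<mu>)) (p / t)" for x
  have "frac_energy \<mu> s p t (ball x (\<Lambda> * r)) u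
      \<le> (\<integral>\<^sup>+z. f z * indicator (ball x (\<Lambda> * r)) z \<partial>(completion \<mu>))" if "x \<in> F" for x
    unfolding frac_energy_def f_def using sub[OF that] pt
    by (intro nn_integral_mono mult_right_mono epowr_mono mult_left_mono) (auto simp: indicator_def)
  then have "(\<Sum>x\<in>F. frac_energy \<mu> s p t (ball x (\<Lambda> * r)) u)
      \<le> (\<Sum>x\<in>F. \<integral>\<^sup>+z. f z * indicator (ball x (\<Lambda> * r)) z \<partial>(completion \<mu>))"
    by (rule sum_mono)
  also have "\<dots> \<le> (\<integral>\<^sup>+z. (\<Sum>x\<in>F. f z * indicator (ball x (\<Lambda> * r)) z) \<partial>(completion \<mu>))"
    by (rule nn_integral_sum_le[OF F(1)])
  also have "\<dots> \<le> (\<integral>\<^sup>+z. ennreal (c ^ k) * (f z * indicator A z) \<partial>(completion \<mu>))"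
  proof (rule nn_integral_mono)
    fix z
    define N where "N = card {x \<in> F. z \<in> ball x (\<Lambda> * r)}"
    have "(\<Sum>x\<in>F. f z * indicator (ball x (\<Lambda> * r)) z) = f z * (\<Sum>x\<in>F. indicator (ball x (\<Lambda> * r)) z)"
      by (rule sum_distrib_left[symmetric])
    also have "(\<Sum>x\<in>F. indicator (ball x (\<Lambda> * r)) z) = (\<Sum>x\<in>{x \<in> F. z \<in> ball x (\<Lambda> * r)}. 1 :: ennreal)"
      using F(1) by (intro sum.mono_neutral_cong_right) (auto simp: indicator_def)
    also have "\<dots> = ennreal (real N)"
      by (simp add: N_def ennreal_of_nat_eq_real_of_nat)
    finally have eq: "(\<Sum>x\<in>F. f z * indicator (ball x (\<Lambda> * r)) z) = f z * ennreal (real N)" .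
    show "(\<Sum>x\<in>F. f z * indicator (ball x (\<Lambda> * r)) z) \<le> ennreal (c ^ k) * (f z * indicator A z)"
    proof (cases "z \<in> A")
      case True
      have "real N \<le> c ^ k"
        unfolding N_def using overlap_card_le[OF F(1) r \<Lambda>(1) F(2) \<Lambda>(2)] .
      then show ?thesis
        using True unfolding eq by (simp add: mult.commute[of _ "f z"] mult_left_mono ennreal_leI)
    next
      case False
      then have "{x \<in> F. z \<in> ball x (\<Lambda> * r)} = {}"
        using sub by blast
      then have "N = 0"
        unfolding N_def by (simp only: card.empty)
      then show ?thesis
        using eq by simp
    qed
  qed
  also have "\<dots> \<le> ennreal (c ^ k) * (\<integral>\<^sup>+z. f z * indicator A z \<partial>(completion \<mu>))"
    using one_le_c by (intro nn_integral_cmult_le) simp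
  finally show ?thesis
    by (simp add: frac_energy_def f_def)
qed

lemma continuous_borel_measurable:
  assumes "continuous_on UNIV u"
  shows "u \<in> borel_measurable \<mu>"
  using borel_measurable_continuous_onI[OF assms] measurable_cong_sets[OF sets_eq_borel refl] by blast

text \<open>Closed balls are compact, so \<open>u\<close> is bounded on them. This makes continuous
  functions admissible in the Poincare inequality.\<close>

lemma continuous_integrable_on_balls:
  fixes u :: "'a \<Rightarrow> real"
  assumes u: "continuous_on UNIV u" and complete: "complete (UNIV :: 'a set)"
  shows "integrable_on_balls \<mu> u"
  unfolding integrable_on_balls_def
proof (intro conjI allI impI)
  show meas: "u \<in> borel_measurable (completion \<mu>)"
    using continuous_borel_measurable[OF u] by (rule measurable_completion)
  fix x r
  have "bounded (u ` cball x r)"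
    using u compact_cball[OF complete]
    by (intro compact_imp_bounded compact_continuous_image) (auto intro: continuous_on_subset)
  then obtain B where "\<forall>y\<in>cball x r. norm (u y) \<le> B"
    unfolding bounded_iff by blast
  then have B: "\<And>y. y \<in> cball x r \<Longrightarrow> norm (u y) \<le> B"
    by blast
  show "set_integrable (completion \<mu>) (ball x r) u"
    unfolding set_integrable_def
    by (rule integrableI_bounded_set_indicator[where B = B])
       (use meas B in \<open>auto simp: emeasure_ball less_imp_le\<close>)
qed

text \<open>The Poincare inequality with real bounds and without the outer root. Any finite upper
  bound \<open>e\<close> of the energy is allowed, so a vanishing energy can be replaced by a
  positive number.\<close>

lemma poincare_deviation_le:
  fixes u :: "'a \<Rightarrow> real"
  assumes poincare: "poincare_inequality \<mu> s q p t cP \<Lambda>"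
    and u: "integrable_on_balls \<mu> u"
    and r: "0 < r" and q: "1 \<le> q" and p: "1 \<le> p" and cP: "0 < cP" and \<Lambda>: "1 \<le> \<Lambda>"
    and e: "frac_energy \<mu> s p t (ball x (\<Lambda> * r)) u \<le> ennreal e" "0 \<le> e"
  defines "T \<equiv> cP * r powr s * (e / measure \<mu> (ball x (\<Lambda> * r))) powr (1 / p)"
  shows "(\<integral>\<^sup>+z\<in>ball x r. ennreal (\<bar>u z - ball_average \<mu> (ball x r) u\<bar> powr q) \<partial>(completion \<mu>))
    \<le> ennreal (T powr q * measure \<mu> (ball x r))"
proof -
  let ?I = "\<integral>\<^sup>+z\<in>ball x r. ennreal (\<bar>u z - ball_average \<mu> (ball x r) u\<bar> powr q) \<partial>(completion \<mu>)"
  let ?m = "measure \<mu> (ball x (\<Lambda> * r))"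
  have m: "0 < ?m" "0 < measure \<mu> (ball x r)"
    using r \<Lambda> by (auto intro!: measure_ball_pos)
  have "T \<ge> 0" unfolding T_def using cP by simp
  have "epowr (?I / emeasure \<mu> (ball x r)) (1 / q)
      \<le> ennreal (cP * r powr s) * epowr (frac_energy \<mu> s p t (ball x (\<Lambda> * r)) u / emeasure \<mu> (ball x (\<Lambda> * r))) (1 / p)"
    using poincare r u unfolding poincare_inequality_def by blast
  also have "\<dots> \<le> ennreal (cP * r powr s) * epowr (ennreal e / ennreal ?m) (1 / p)"
    using e p by (intro mult_left_mono epowr_mono) (auto simp: emeasure_ball divide_right_mono_ennreal)
  also have "\<dots> = ennreal T"
    unfolding T_def using m e cP by (simp add: divide_ennreal ennreal_mult max_def)
  finally have "?I / emeasure \<mu> (ball x r) \<le> ennreal (T powr q)"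
    using q \<open>T \<ge> 0\<close> by (intro le_of_epowr_le) auto
  then have "?I \<le> ennreal (T powr q) * emeasure \<mu> (ball x r)"
    using m mult_right_mono[of "?I / emeasure \<mu> (ball x r)" _ "emeasure \<mu> (ball x r)"]
    by (simp add: ennreal_divide_times emeasure_ball)
  then show ?thesis
    by (simp add: emeasure_ball ennreal_mult)
qed

text \<open>\<open>average_deviation_le\<close> with the ratio of measures absorbed into
  \<open>\<kappa>\<close>. The constant \<open>a\<close> is free: it is the average over the larger
  ball when descending the tree, and zero in the last generation.\<close>

lemma ball_average_diff_le:
  fixes u :: "'a \<Rightarrow> real"
  assumes u: "integrable_on_balls \<mu> u"
    and ball: "0 < \<rho>" "ball y \<rho> \<subseteq> ball x r" "measure \<mu> (ball x r) \<le> \<kappa> * measure \<mu> (ball y \<rho>)"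
    and q: "1 \<le> q" and T: "0 \<le> T"
    and le: "(\<integral>\<^sup>+z\<in>ball x r. ennreal (\<bar>u z - a\<bar> powr q) \<partial>(completion \<mu>)) \<le> ennreal (T powr q * measure \<mu> (ball x r))"
  shows "\<bar>ball_average \<mu> (ball y \<rho>) u - a\<bar> \<le> 2 * T * \<kappa>"
proof -
  have pos: "0 < measure \<mu> (ball y \<rho>)"
    using ball by (simp add: measure_ball_pos)
  have "\<bar>ball_average \<mu> (ball y \<rho>) u - a\<bar> \<le> 2 * T * measure \<mu> (ball x r) / measure \<mu> (ball y \<rho>)"
    using average_deviation_le[of "ball y \<rho>" "completion \<mu>" "ball x r" u q T a] ball pos u q T le
    by (simp add: integrable_on_balls_def ball_average_def emeasure_ball)
  also have "\<dots> \<le> 2 * T * \<kappa>"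
    using pos T ball(3) mult_left_mono[of "measure \<mu> (ball x r)" "\<kappa> * measure \<mu> (ball y \<rho>)" "2 * T"]
    by (simp add: pos_divide_le_eq mult_ac)
  finally show ?thesis .
qed

end


text \<open>Since \<open>\<bar>u x\<bar>\<close> is at most twice the maximum of
  \<open>\<bar>u x - a\<bar>\<close> and \<open>S\<close>, the factor \<open>2 powr q\<close>
  appears; one more 2 comes from adding two terms with the same bound.\<close>

lemma nn_integral_powr_le:
  fixes u :: "'b \<Rightarrow> real"
  assumes M: "B \<in> sets M" "u \<in> borel_measurable M" "emeasure M B = ennreal m" "0 \<le> m"
    and q: "1 \<le> q" and a: "\<bar>a\<bar> \<le> S"
    and le: "(\<integral>\<^sup>+x\<in>B. ennreal (\<bar>u x - a\<bar> powr q) \<partial>M) \<le> ennreal (S powr q * m)"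
  shows "(\<integral>\<^sup>+x\<in>B. ennreal (\<bar>u x\<bar> powr q) \<partial>M) \<le> ennreal (2 powr (q + 1) * S powr q * m)"
proof -
  have pointwise: "\<bar>u x\<bar> powr q \<le> 2 powr q * (\<bar>u x - a\<bar> powr q + S powr q)" for x
  proof -
    have "\<bar>u x\<bar> \<le> \<bar>u x - a\<bar> + \<bar>a\<bar>"
      using abs_triangle_ineq[of "u x - a" a] by simp
    also have "\<dots> \<le> 2 * max \<bar>u x - a\<bar> S"
      unfolding mult_2 using a by (intro add_mono) auto
    finally have "\<bar>u x\<bar> \<le> 2 * max \<bar>u x - a\<bar> S" .
    then have "\<bar>u x\<bar> powr q \<le> (2 * max \<bar>u x - a\<bar> S) powr q"
      using q by (intro powr_mono2) auto
    also have "\<dots> = 2 powr q * max \<bar>u x - a\<bar> S powr q"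
      by (rule powr_mult)
    also have "\<dots> \<le> 2 powr q * (\<bar>u x - a\<bar> powr q + S powr q)"
      by (intro mult_left_mono) (auto simp: max_def)
    finally show ?thesis .
  qed
  have "(\<integral>\<^sup>+x\<in>B. ennreal (\<bar>u x\<bar> powr q) \<partial>M)
      \<le> (\<integral>\<^sup>+x. ennreal (2 powr q) * (ennreal (\<bar>u x - a\<bar> powr q) * indicator B x + ennreal (S powr q) * indicator B x) \<partial>M)"
  proof (intro nn_integral_mono)
    fix x
    show "ennreal (\<bar>u x\<bar> powr q) * indicator B x
        \<le> ennreal (2 powr q) * (ennreal (\<bar>u x - a\<bar> powr q) * indicator B x + ennreal (S powr q) * indicator B x)"
      using ennreal_leI[OF pointwise[of x]] by (cases "x \<in> B") (auto simp: ennreal_mult)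
  qed
  also have "\<dots> = ennreal (2 powr q) * ((\<integral>\<^sup>+x\<in>B. ennreal (\<bar>u x - a\<bar> powr q) \<partial>M) + ennreal (S powr q) * emeasure M B)"
    using M by (subst nn_integral_cmult, simp, subst nn_integral_add) (auto simp: nn_integral_cmult)
  also have "\<dots> \<le> ennreal (2 powr q) * (ennreal (S powr q * m) + ennreal (S powr q) * ennreal m)"
    using le M(3) by (intro mult_left_mono add_mono) auto
  also have "\<dots> = ennreal (2 powr q * (S powr q * m + S powr q * m))"
    using M(4) by (simp only: ennreal_mult ennreal_plus powr_ge_zero mult_nonneg_nonneg add_nonneg_nonneg)
  also have "2 powr q * (S powr q * m + S powr q * m) = 2 powr (q + 1) * S powr q * m"
    by (simp add: powr_add)
  finally show ?thesis .
qed

section \<open>Oscillation estimates along the tree\<close>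

context branching_set
begin

text \<open>The weight bound cancels the normalisation of each energy mean at the price of
  \<open>1 / \<delta> ^ n\<close>, leaving a plain sum of energies; bounded overlap then gives the
  first \<open>c ^ k\<close>.\<close>

lemma weighted_energy_le:
  fixes e :: "'a \<Rightarrow> real"
  assumes gen: "generation n F W"
    and k: "2 * \<Lambda> + 1 \<le> 2 ^ k"
    and e: "\<And>x. x \<in> F \<Longrightarrow> frac_energy \<mu> s p t (ball x (\<Lambda> * (\<epsilon> ^ n * R))) u = ennreal (e x)"
      "\<And>x. x \<in> F \<Longrightarrow> 0 \<le> e x"
    and g: "frac_energy \<mu> s p t (ball w (\<Lambda> * R)) u \<le> ennreal g" "0 \<le> g"
    and pt: "0 < p" "0 < t"
  shows "(\<Sum>x\<in>F. W x * (e x / measure \<mu> (ball x (\<Lambda> * (\<epsilon> ^ n * R)))))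
    \<le> c ^ k * c ^ k * g / measure \<mu> (ball w (\<Lambda> * R)) / \<delta> ^ n"
proof -
  define \<rho> where "\<rho> = \<epsilon> ^ n * R"
  let ?V = "measure \<mu> (ball w R)"
  have \<rho>: "0 < \<rho>" "\<rho> \<le> \<Lambda> * \<rho>"
    unfolding \<rho>_def using radius_pos[of n] mult_right_mono[OF \<Lambda>, of "\<epsilon> ^ n * R"] by auto
  have F: "finite F" "disjoint_family_on (\<lambda>x. ball x \<rho>) F"
    and inside: "\<And>x. x \<in> F \<Longrightarrow> dist x w + \<Lambda> * \<rho> \<le> \<Lambda> * R"
    and W: "\<And>x. x \<in> F \<Longrightarrow> W x * \<delta> ^ n * ?V \<le> measure \<mu> (ball x \<rho>)"
    using gen unfolding generation_def \<rho>_def by auto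
  have V: "0 < ?V" "0 < measure \<mu> (ball w (\<Lambda> * R))"
    using R \<Lambda> by (auto intro!: measure_ball_pos)
  have "ennreal (\<Sum>x\<in>F. e x) = (\<Sum>x\<in>F. ennreal (e x))"
    using e(2) by (rule sum_ennreal[symmetric])
  also have "\<dots> = (\<Sum>x\<in>F. frac_energy \<mu> s p t (ball x (\<Lambda> * \<rho>)) u)"
    unfolding \<rho>_def using e(1) by (intro sum.cong) simp_all
  also have "\<dots> \<le> ennreal (c ^ k) * frac_energy \<mu> s p t (ball w (\<Lambda> * R)) u"
    using F \<rho>(1) \<Lambda> k inside pt by (intro sum_frac_energy_le ball_subset_ballI) auto
  also have "\<dots> \<le> ennreal (c ^ k) * ennreal g"
    using g by (intro mult_left_mono) auto
  also have "\<dots> = ennreal (c ^ k * g)"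
    using g one_le_c by (simp add: ennreal_mult)
  finally have sum_e: "(\<Sum>x\<in>F. e x) \<le> c ^ k * g"
    using g one_le_c by (simp add: ennreal_le_iff)
  have "(\<Sum>x\<in>F. W x * (e x / measure \<mu> (ball x (\<Lambda> * \<rho>)))) \<le> (\<Sum>x\<in>F. e x / (\<delta> ^ n * ?V))"
  proof (rule sum_mono)
    fix x assume x: "x \<in> F"
    have m: "0 < measure \<mu> (ball x (\<Lambda> * \<rho>))"
      using \<rho> by (intro measure_ball_pos) auto
    have "W x * \<delta> ^ n * ?V \<le> measure \<mu> (ball x (\<Lambda> * \<rho>))"
      using \<rho>(2) by (intro order_trans[OF W[OF x] measure_mono_fmeasurable] subset_ball) auto
    moreover have "0 < \<delta> ^ n * ?V"
      using V \<delta> by simp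
    ultimately have "W x \<le> measure \<mu> (ball x (\<Lambda> * \<rho>)) / (\<delta> ^ n * ?V)"
      by (simp only: pos_le_divide_eq mult.assoc)
    then have "W x * (e x / measure \<mu> (ball x (\<Lambda> * \<rho>)))
        \<le> measure \<mu> (ball x (\<Lambda> * \<rho>)) / (\<delta> ^ n * ?V) * (e x / measure \<mu> (ball x (\<Lambda> * \<rho>)))"
      using e(2)[OF x] m by (intro mult_right_mono) auto
    also have "\<dots> = e x / (\<delta> ^ n * ?V)"
      using m by simp
    finally show "W x * (e x / measure \<mu> (ball x (\<Lambda> * \<rho>))) \<le> e x / (\<delta> ^ n * ?V)" .
  qed
  also have "\<dots> = (\<Sum>x\<in>F. e x) / (\<delta> ^ n * ?V)"
    by (rule sum_divide_distrib[symmetric])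
  also have "\<dots> \<le> c ^ k * g / (\<delta> ^ n * ?V)"
    using sum_e V \<delta> by (intro divide_right_mono) auto
  also have "\<dots> = c ^ k * g / \<delta> ^ n * (1 / ?V)"
    by simp
  \<comment> \<open>The second \<open>c ^ k\<close> exchanges \<open>ball w R\<close> for
    \<open>ball w (\<Lambda> * R)\<close>, as \<open>\<Lambda> <= 2 ^ k\<close>.\<close>
  also have "\<dots> \<le> c ^ k * g / \<delta> ^ n * (c ^ k / measure \<mu> (ball w (\<Lambda> * R)))"
  proof (rule mult_left_mono)
    have "\<Lambda> * R \<le> 2 ^ k * R"
      using k R \<Lambda> by (intro mult_right_mono) auto
    then have "measure \<mu> (ball w (\<Lambda> * R)) \<le> c ^ k * ?V"
      using R by (intro measure_le_ball subset_ball) auto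
    then show "1 / ?V \<le> c ^ k / measure \<mu> (ball w (\<Lambda> * R))"
      using V by (simp add: pos_divide_le_eq pos_le_divide_eq)
  qed (use g one_le_c \<delta> in auto)
  finally show ?thesis
    by (simp add: \<rho>_def mult_ac)
qed

text \<open>\<open>u\<close> vanishes at the centres and is uniformly continuous on a compact ball
  containing all the balls of the tree. The index \<open>n\<close> is uniform in \<open>F\<close>
  and \<open>W\<close>, because the generation is obtained only after \<open>n\<close> is
  fixed.\<close>

lemma eventually_averages_small:
  fixes u :: "'a \<Rightarrow> real"
  assumes u: "continuous_on UNIV u" and zero: "\<And>x. x \<in> E \<Longrightarrow> u x = 0"
    and complete: "complete (UNIV :: 'a set)" and \<eta>: "0 < \<eta>"
  obtains n where "\<And>F W x. generation n F W \<Longrightarrow> x \<in> F \<Longrightarrow> \<bar>ball_average \<mu> (ball x (\<epsilon> ^ n * R)) u\<bar> \<le> 2 * \<eta>"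
proof -
  have "uniformly_continuous_on (cball w (\<Lambda> * R)) u"
    using compact_uniformly_continuous[OF _ compact_cball[OF complete]] continuous_on_subset[OF u] by blast
  then obtain d where d: "0 < d"
      "\<And>x y. x \<in> cball w (\<Lambda> * R) \<Longrightarrow> y \<in> cball w (\<Lambda> * R) \<Longrightarrow> dist y x < d \<Longrightarrow> dist (u y) (u x) < \<eta>"
    using \<eta> unfolding uniformly_continuous_on_def by meson
  obtain n where n: "\<epsilon> ^ n < d / R"
    using real_arch_pow_inv[of "d / R" \<epsilon>] d(1) R \<epsilon> by auto
  have "\<bar>ball_average \<mu> (ball x (\<epsilon> ^ n * R)) u\<bar> \<le> 2 * \<eta>" if gen: "generation n F W" and x: "x \<in> F" for F W x
  proof -
    define \<rho> where "\<rho> = \<epsilon> ^ n * R"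
    have \<rho>: "0 < \<rho>" "\<rho> < d" "\<rho> \<le> \<Lambda> * \<rho>"
      unfolding \<rho>_def using radius_pos[of n] mult_right_mono[OF \<Lambda>, of "\<epsilon> ^ n * R"] n R
      by (auto simp: pos_less_divide_eq)
    have xE: "x \<in> E" and xw: "dist x w + \<Lambda> * \<rho> \<le> \<Lambda> * R"
      using gen x unfolding generation_def \<rho>_def by auto
    \<comment> \<open>Written with \<open>0\<close> and exponent 1 so that
      \<open>ball_average_diff_le\<close> applies with \<open>a = 0\<close>, \<open>q = 1\<close>
      and equal balls.\<close>
    have "\<bar>u z - 0\<bar> powr 1 \<le> \<eta>" if z: "z \<in> ball x \<rho>" for z
    proof -
      have "ball x \<rho> \<subseteq> ball w (\<Lambda> * R)"
        using xw \<rho>(3) by (intro ball_subset_ballI) linarith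
      then have "z \<in> ball w (\<Lambda> * R)"
        using z by blast
      moreover have "dist x w \<le> \<Lambda> * R"
        using xw \<rho> by linarith
      ultimately show ?thesis
        using d(2)[of x z] z \<rho> zero[OF xE] by (auto simp: dist_commute dist_real_def)
    qed
    then have "(\<integral>\<^sup>+z\<in>ball x \<rho>. ennreal (\<bar>u z - 0\<bar> powr 1) \<partial>(completion \<mu>))
        \<le> (\<integral>\<^sup>+z. ennreal \<eta> * indicator (ball x \<rho>) z \<partial>(completion \<mu>))"
      by (intro nn_integral_mono) (auto simp: indicator_def intro!: ennreal_leI)
    also have "\<dots> = ennreal (\<eta> powr 1 * measure \<mu> (ball x \<rho>))"
      using \<eta> by (subst nn_integral_cmult_indicator) (auto simp: emeasure_ball ennreal_mult)
    finally have "\<bar>ball_average \<mu> (ball x \<rho>) u - 0\<bar> \<le> 2 * \<eta> * 1"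
      using \<rho>(1) \<eta> continuous_integrable_on_balls[OF u complete]
      by (intro ball_average_diff_le[of u \<rho> x x \<rho> 1 1 \<eta> 0]) auto
    then show ?thesis
      by (simp add: \<rho>_def)
  qed
  then show thesis by (rule that)
qed

text \<open>Telescoping of the absolute averages: the generations contribute a geometric series of
  ratio \<open>\<epsilon> powr s / \<delta> powr (1 / p)\<close>, the last one an arbitrarily small
  rest. A positive \<open>g\<close> is used because the substitute for Jensen's inequality needs a
  positive bound.\<close>

lemma average_le:
  fixes u :: "'a \<Rightarrow> real"
  assumes poincare: "poincare_inequality \<mu> s q p t cP \<Lambda>"
    and u: "continuous_on UNIV u" and zero: "\<And>x. x \<in> E \<Longrightarrow> u x = 0"
    and complete: "complete (UNIV :: 'a set)"
    and exponents: "1 \<le> p" "1 \<le> q" "1 \<le> t" and cP: "0 < cP"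
    and k: "2 * \<Lambda> + 1 \<le> 2 ^ k" and j: "2 \<le> 2 ^ j * \<epsilon>"
    and \<theta>: "\<epsilon> powr s / \<delta> powr (1 / p) < 1"
    and g: "frac_energy \<mu> s p t (ball w (\<Lambda> * R)) u \<le> ennreal g" "0 < g"
  shows "\<bar>ball_average \<mu> (ball w R) u\<bar> \<le>
    4 * c ^ j * cP * (c ^ k * c ^ k) powr (1 / p) / (1 - \<epsilon> powr s / \<delta> powr (1 / p)) *
      R powr s * (g / measure \<mu> (ball w (\<Lambda> * R))) powr (1 / p)"
proof -
  \<comment> \<open>\<open>enn2real\<close> sends infinity to 0; \<open>e\<close> is used only for
    balls whose dilation lies in \<open>ball w (\<Lambda> * R)\<close>, where the energy is
    finite.\<close>
  define e where "e x r = enn2real (frac_energy \<mu> s p t (ball x (\<Lambda> * r)) u)" for x r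
  define D where "D x r = (e x r / measure \<mu> (ball x (\<Lambda> * r))) powr (1 / p)" for x r
  define T where "T x r = 2 * (cP * r powr s * D x r) * c ^ j" for x r
  define m where "m = measure \<mu> (ball w (\<Lambda> * R))"
  define B where "B = (c ^ k * c ^ k * g / m) powr (1 / p)"
  define \<theta>' where "\<theta>' = \<epsilon> powr s / \<delta> powr (1 / p)"
  \<comment> \<open>The 4 collects a 2 from \<open>T\<close> and a 2 from the substitute for
    Jensen's inequality.\<close>
  define A where "A = 4 * c ^ j * cP * R powr s * B"
  have m: "0 < m" unfolding m_def using R \<Lambda> by (intro measure_ball_pos) auto
  have B: "0 < B" unfolding B_def using m g one_le_c by simp
  have \<theta>'_bounds: "0 < \<theta>'" "\<theta>' < 1"
    using \<theta> \<epsilon> \<delta> by (auto simp: \<theta>'_def)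
  have A: "0 \<le> A" unfolding A_def using B cP one_le_c by simp
  note integrable = continuous_integrable_on_balls[OF u complete]
  have e: "frac_energy \<mu> s p t (ball x (\<Lambda> * r)) u = ennreal (e x r)" "0 \<le> e x r"
    if "dist x w + \<Lambda> * r \<le> \<Lambda> * R" for x r
  proof -
    have "frac_energy \<mu> s p t (ball x (\<Lambda> * r)) u \<le> frac_energy \<mu> s p t (ball w (\<Lambda> * R)) u"
      using that exponents by (intro frac_energy_mono ball_subset_ballI) auto
    then have "frac_energy \<mu> s p t (ball x (\<Lambda> * r)) u < top"
      using g(1) by (meson ennreal_less_top le_less_trans)
    then show "frac_energy \<mu> s p t (ball x (\<Lambda> * r)) u = ennreal (e x r)" "0 \<le> e x r"
      by (auto simp: e_def)
  qed
  have step: "\<bar>ball_average \<mu> (ball x r) u\<bar> \<le> \<bar>ball_average \<mu> (ball y (\<epsilon> * r)) u\<bar> + T x r"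
    if "0 < r" "dist x w + \<Lambda> * r \<le> \<Lambda> * R" "y \<in> ball x (3 / 4 * r)" for x y r
  proof -
    have \<epsilon>r: "\<epsilon> * r \<le> r / 4" "0 < \<epsilon> * r"
      using \<epsilon> that mult_right_mono[of \<epsilon> "1 / 4" r] by auto
    \<comment> \<open>The choice of \<open>j\<close> makes the \<open>2 ^ j\<close>-fold enlargement
      of the child's ball cover the parent's ball.\<close>
    have "2 * r \<le> 2 ^ j * (\<epsilon> * r)"
      using mult_right_mono[OF j, of r] that by (simp add: mult.assoc)
    moreover have "dist x y < r"
      using that by simp
    ultimately have "ball x r \<subseteq> ball y (2 ^ j * (\<epsilon> * r))"
      by (intro ball_subset_ballI) linarith
    then have "measure \<mu> (ball x r) \<le> c ^ j * measure \<mu> (ball y (\<epsilon> * r))"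
      using \<epsilon>r by (intro measure_le_ball) auto
    moreover have "ball y (\<epsilon> * r) \<subseteq> ball x r"
      using that \<epsilon>r by (intro ball_subset_ballI) (auto simp: dist_commute)
    moreover have "(\<integral>\<^sup>+z\<in>ball x r. ennreal (\<bar>u z - ball_average \<mu> (ball x r) u\<bar> powr q) \<partial>(completion \<mu>))
        \<le> ennreal ((cP * r powr s * D x r) powr q * measure \<mu> (ball x r))"
      unfolding D_def using e[OF that(2)]
      by (intro poincare_deviation_le[OF poincare integrable that(1) exponents(2,1) cP \<Lambda>]) auto
    ultimately have "\<bar>ball_average \<mu> (ball y (\<epsilon> * r)) u - ball_average \<mu> (ball x r) u\<bar> \<le> T x r"
      unfolding T_def using \<epsilon>r cP
      by (intro ball_average_diff_le[OF integrable _ _ _ exponents(2)]) (auto simp: D_def)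
    then show ?thesis by linarith
  qed
  \<comment> \<open>The radius contributes \<open>\<epsilon> powr s\<close> per generation, and the
    weighted energy bound, after taking the p-th root,
    \<open>1 / \<delta> powr (1 / p)\<close>.\<close>
  have T_le: "(\<Sum>x\<in>F. W x * T x (\<epsilon> ^ n * R)) \<le> A * \<theta>' ^ n" if gen: "generation n F W" for n F W
  proof -
    define \<rho> where "\<rho> = \<epsilon> ^ n * R"
    define b where "b = B / (\<delta> powr (1 / p)) ^ n"
    have inside: "\<And>x. x \<in> F \<Longrightarrow> dist x w + \<Lambda> * \<rho> \<le> \<Lambda> * R" and W: "\<And>x. x \<in> F \<Longrightarrow> 0 \<le> W x" "sum W F = 1"
      using gen unfolding generation_def \<rho>_def by auto
    have power_powr: "(x powr a) ^ n = (x ^ n) powr a" if "0 < x" for x a :: real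
      using that by (simp add: powr_realpow[symmetric] powr_powr mult.commute)
    have b: "0 < b" "b powr p = c ^ k * c ^ k * g / m / \<delta> ^ n"
      using B \<delta> exponents one_le_c g m
      by (auto simp: b_def B_def power_powr powr_divide[symmetric] powr_powr)
    have "(\<Sum>x\<in>F. W x * D x \<rho> powr p) = (\<Sum>x\<in>F. W x * (e x \<rho> / measure \<mu> (ball x (\<Lambda> * \<rho>))))"
      using exponents e(2) inside by (intro sum.cong) (auto simp: D_def powr_powr)
    also have "\<dots> \<le> b powr p"
      unfolding b(2) m_def \<rho>_def using exponents e g inside
      by (intro weighted_energy_le[OF gen k, where s = s and p = p and t = t and u = u]) (auto simp: \<rho>_def)
    finally have "(\<Sum>x\<in>F. W x * D x \<rho>) \<le> 2 * b"
      using b W exponents by (intro sum_weighted_le_of_sum_powr_le) (auto simp: D_def)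
    then have "2 * cP * \<rho> powr s * c ^ j * (\<Sum>x\<in>F. W x * D x \<rho>) \<le> 2 * cP * \<rho> powr s * c ^ j * (2 * b)"
      using cP one_le_c by (intro mult_left_mono) auto
    moreover have "(\<Sum>x\<in>F. W x * T x \<rho>) = 2 * cP * \<rho> powr s * c ^ j * (\<Sum>x\<in>F. W x * D x \<rho>)"
      by (simp add: T_def sum_distrib_left mult_ac)
    moreover have "2 * cP * \<rho> powr s * c ^ j * (2 * b) = A * \<theta>' ^ n"
      using \<epsilon>(1) by (simp add: A_def b_def \<theta>'_def \<rho>_def powr_mult power_divide power_powr)
    ultimately show ?thesis
      by (fold \<rho>_def) linarith
  qed
  have "\<bar>ball_average \<mu> (ball w R) u\<bar> \<le> A / (1 - \<theta>') + 2 * \<eta>" if \<eta>: "0 < \<eta>" for \<eta>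
  proof -
    obtain n where small: "\<And>F W x. generation n F W \<Longrightarrow> x \<in> F \<Longrightarrow> \<bar>ball_average \<mu> (ball x (\<epsilon> ^ n * R)) u\<bar> \<le> 2 * \<eta>"
      by (rule eventually_averages_small[OF u zero complete \<eta>]) auto
    obtain F W where gen: "generation n F W"
      and le: "\<bar>ball_average \<mu> (ball w R) u\<bar> \<le> (\<Sum>i<n. A * \<theta>' ^ i) + (\<Sum>x\<in>F. W x * \<bar>ball_average \<mu> (ball x (\<epsilon> ^ n * R)) u\<bar>)"
      using telescoping_le[of "\<lambda>x r. \<bar>ball_average \<mu> (ball x r) u\<bar>" T "\<lambda>i. A * \<theta>' ^ i" n] step T_le by blast
    have "(\<Sum>i<n. A * \<theta>' ^ i) = A * ((1 - \<theta>' ^ n) / (1 - \<theta>'))"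
      using \<theta>'_bounds by (simp add: sum_distrib_left[symmetric] sum_gp_strict)
    also have "\<dots> \<le> A * (1 / (1 - \<theta>'))"
      using A \<theta>'_bounds by (intro mult_left_mono divide_right_mono) auto
    finally have "(\<Sum>i<n. A * \<theta>' ^ i) \<le> A / (1 - \<theta>')" by simp
    moreover have "(\<Sum>x\<in>F. W x * \<bar>ball_average \<mu> (ball x (\<epsilon> ^ n * R)) u\<bar>) \<le> (\<Sum>x\<in>F. W x * (2 * \<eta>))"
      using gen small[OF gen] unfolding generation_def by (intro sum_mono mult_left_mono) auto
    moreover have "(\<Sum>x\<in>F. W x * (2 * \<eta>)) = 2 * \<eta>"
      using gen unfolding generation_def by (simp flip: sum_distrib_right)
    ultimately show ?thesis
      using le by linarith
  qed
  then have "\<bar>ball_average \<mu> (ball w R) u\<bar> \<le> A / (1 - \<theta>') + \<eta>" if "0 < \<eta>" for \<eta>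
    using that by (metis field_sum_of_halves half_gt_zero mult_2)
  then have "\<bar>ball_average \<mu> (ball w R) u\<bar> \<le> A / (1 - \<theta>')"
    by (rule field_le_epsilon)
  also have "B = (c ^ k * c ^ k) powr (1 / p) * (g / m) powr (1 / p)"
    unfolding B_def by (simp flip: powr_mult)
  then have "A / (1 - \<theta>') = 4 * c ^ j * cP * (c ^ k * c ^ k) powr (1 / p) / (1 - \<theta>') * R powr s * (g / m) powr (1 / p)"
    by (simp add: A_def)
  finally show ?thesis
    by (simp only: \<theta>'_def m_def)
qed

end

section \<open>Branching from the codimension bound\<close>

context doubling_space
begin

text \<open>An admissible exponent \<open>Q < a\<close> gives children of relative measure
  comparable to \<open>\<epsilon> powr Q\<close>, which exceeds \<open>\<epsilon> powr a\<close>
  once \<open>\<epsilon>\<close> is small.\<close>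

lemma thick_set_branching:
  assumes codim: "upper_assouad_codim \<mu> E < ereal a"
  obtains \<epsilon> \<delta> where "0 < \<epsilon>" "\<epsilon> \<le> 1 / 4" "\<epsilon> powr a < \<delta>"
    "\<And>x r. \<lbrakk>x \<in> E; 0 < r; ennreal r < ediam E\<rbrakk> \<Longrightarrow> \<exists>S. finite S \<and> S \<subseteq> E \<inter> ball x (3 / 4 * r) \<and>
      disjoint_family_on (\<lambda>y. ball y (\<epsilon> * r)) S \<and>
      \<delta> * measure \<mu> (ball x r) \<le> (\<Sum>y\<in>S. measure \<mu> (ball y (\<epsilon> * r)))"
proof -
  obtain Q b where Q: "0 \<le> Q" "Q < a" and b: "0 < b"
    and thick: "\<And>x r R. \<lbrakk>x \<in> E; 0 < r; r < R; ennreal R < ediam E\<rbrakk> \<Longrightarrow>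
      b * (r / R) powr Q \<le> measure \<mu> ({y. infdist y E < r} \<inter> ball x R) / measure \<mu> (ball x R)"
    using codim unfolding upper_assouad_codim_def Inf_less_iff by auto
  \<comment> \<open>Chosen so that \<open>\<epsilon> powr (a - Q) <= b / (2 * c ^ 3)\<close>; the 2
    makes the comparison with \<open>b / c ^ 3\<close> strict, and \<open>1 / 4\<close> is the limit
    in \<open>children_exist\<close>.\<close>
  define \<epsilon> where "\<epsilon> = min (1 / 4) ((b / (2 * c ^ 3)) powr (1 / (a - Q)))"
  define \<delta> where "\<delta> = b * (2 * \<epsilon>) powr Q / c ^ 3"
  have c3: "0 < c ^ 3" using one_le_c by simp
  have \<epsilon>: "0 < \<epsilon>" "\<epsilon> \<le> 1 / 4"
    using b c3 by (auto simp: \<epsilon>_def)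
  have "\<epsilon> powr (a - Q) \<le> ((b / (2 * c ^ 3)) powr (1 / (a - Q))) powr (a - Q)"
    using Q \<epsilon> by (intro powr_mono2) (auto simp: \<epsilon>_def)
  also have "\<dots> = b / (2 * c ^ 3)"
    using Q b c3 by (simp add: powr_powr)
  also have "\<dots> < b / c ^ 3"
    using b c3 by (simp add: field_simps)
  finally have "\<epsilon> powr (a - Q) * \<epsilon> powr Q < b / c ^ 3 * \<epsilon> powr Q"
    using \<epsilon> by (intro mult_strict_right_mono) auto
  also have "\<dots> \<le> b / c ^ 3 * (2 * \<epsilon>) powr Q"
    using \<epsilon> b c3 Q by (intro mult_left_mono powr_mono2) auto
  finally have "\<epsilon> powr a < \<delta>"
    by (simp add: \<delta>_def flip: powr_add)
  moreover have "\<exists>S. finite S \<and> S \<subseteq> E \<inter> ball x (3 / 4 * r) \<and>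
      disjoint_family_on (\<lambda>y. ball y (\<epsilon> * r)) S \<and>
      \<delta> * measure \<mu> (ball x r) \<le> (\<Sum>y\<in>S. measure \<mu> (ball y (\<epsilon> * r)))"
    if x: "x \<in> E" and r: "0 < r" "ennreal r < ediam E" for x r
  proof -
    \<comment> \<open>The codimension condition is applied in \<open>ball x (r / 2)\<close> with
      neighbourhood radius \<open>\<epsilon> * r\<close>, hence the ratio
      \<open>2 * \<epsilon>\<close> in \<open>\<delta>\<close>.\<close>
    have "ennreal (r / 2) < ediam E"
      using r by (elim le_less_trans[rotated]) (simp add: ennreal_leI)
    moreover have "\<epsilon> * r < r / 2"
      using r mult_right_mono[OF \<epsilon>(2), of r] by simp
    ultimately have "b * (\<epsilon> * r / (r / 2)) powr Q
        \<le> measure \<mu> ({y. infdist y E < \<epsilon> * r} \<inter> ball x (r / 2)) / measure \<mu> (ball x (r / 2))"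
      using \<epsilon> r by (intro thick x) auto
    moreover have "\<epsilon> * r / (r / 2) = 2 * \<epsilon>"
      using r by simp
    ultimately have thick_x: "b * (2 * \<epsilon>) powr Q * measure \<mu> (ball x (r / 2))
        \<le> measure \<mu> ({y. infdist y E < \<epsilon> * r} \<inter> ball x (r / 2))"
      using measure_ball_pos[of "r / 2" x] r by (simp only: pos_le_divide_eq half_gt_zero)
    have "0 \<le> b * (2 * \<epsilon>) powr Q"
      using b by simp
    then obtain S where "finite S" "S \<subseteq> E \<inter> ball x (3 / 4 * r)" "disjoint_family_on (\<lambda>y. ball y (\<epsilon> * r)) S"
      "\<delta> * measure \<mu> (ball x r) \<le> (\<Sum>y\<in>S. measure \<mu> (ball y (\<epsilon> * r)))"
      unfolding \<delta>_def by (rule children_exist[OF x r(1) \<epsilon> thick_x])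
    then show ?thesis by blast
  qed
  ultimately show thesis
    using that \<epsilon> by blast
qed

end

section \<open>The \<open>L^q\<close> estimate on a single ball\<close>

context branching_set
begin

text \<open>The deviation of \<open>u\<close> from its average and the average itself are both
  bounded through the same \<open>S\<close>; raising to \<open>p / q\<close> turns
  \<open>S powr q\<close> into \<open>S powr p\<close>. The estimate is shown for every positive
  \<open>g\<close> above the energy, since the energy may be zero.\<close>

lemma mazya_le:
  fixes u :: "'a \<Rightarrow> real"
  assumes poincare: "poincare_inequality \<mu> s q p t cP \<Lambda>"
    and u: "continuous_on UNIV u" and zero: "\<And>x. x \<in> E \<Longrightarrow> u x = 0"
    and complete: "complete (UNIV :: 'a set)"
    and exponents: "1 \<le> p" "1 \<le> q" "1 \<le> t" and cP: "0 < cP"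
    and K: "0 < K"
    and average: "\<And>g. \<lbrakk>frac_energy \<mu> s p t (ball w (\<Lambda> * R)) u \<le> ennreal g; 0 < g\<rbrakk> \<Longrightarrow>
      \<bar>ball_average \<mu> (ball w R) u\<bar> \<le> K * R powr s * (g / measure \<mu> (ball w (\<Lambda> * R))) powr (1 / p)"
  shows "epowr ((\<integral>\<^sup>+x\<in>ball w R. ennreal (\<bar>u x\<bar> powr q) \<partial>\<mu>) / emeasure \<mu> (ball w R)) (p / q)
      \<le> ennreal ((2 powr (q + 1)) powr (p / q) * (cP + K) powr p * R powr (s * p)) *
          (frac_energy \<mu> s p t (ball w (\<Lambda> * R)) u / emeasure \<mu> (ball w (\<Lambda> * R)))" (is "?L \<le> ennreal ?C * (?e / _)")
proof -
  let ?m = "measure \<mu> (ball w (\<Lambda> * R))" and ?V = "measure \<mu> (ball w R)"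
  have m: "0 < ?m" "0 < ?V"
    using R \<Lambda> by (auto intro!: measure_ball_pos)
  have C: "0 < ?C" using K cP R by simp
  have le: "?L \<le> ennreal (?C * (g / ?m))" if g: "?e \<le> ennreal g" "0 < g" for g
  proof -
    define G where "G = (g / ?m) powr (1 / p)"
    define S where "S = (cP + K) * R powr s * G"
    have nonneg: "0 \<le> cP * R powr s * G" "0 \<le> K * R powr s * G"
      using cP K by (auto simp: G_def)
    have S_ge: "cP * R powr s * G \<le> S" "K * R powr s * G \<le> S"
      using nonneg unfolding S_def distrib_right by linarith+
    have "(\<integral>\<^sup>+x\<in>ball w R. ennreal (\<bar>u x - ball_average \<mu> (ball w R) u\<bar> powr q) \<partial>(completion \<mu>))
        \<le> ennreal ((cP * R powr s * G) powr q * ?V)"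
      unfolding G_def using R exponents cP \<Lambda> g
      by (intro poincare_deviation_le[OF poincare continuous_integrable_on_balls[OF u complete]]) auto
    also have "\<dots> \<le> ennreal (S powr q * ?V)"
      using nonneg(1) S_ge exponents by (intro ennreal_leI mult_right_mono powr_mono2) auto
    finally have dev: "(\<integral>\<^sup>+x\<in>ball w R. ennreal (\<bar>u x - ball_average \<mu> (ball w R) u\<bar> powr q) \<partial>\<mu>)
        \<le> ennreal (S powr q * ?V)"
      by (simp add: nn_integral_completion)
    have "\<bar>ball_average \<mu> (ball w R) u\<bar> \<le> S"
      using order_trans[OF average[OF g] S_ge(2)[unfolded G_def]] .
    then have "(\<integral>\<^sup>+x\<in>ball w R. ennreal (\<bar>u x\<bar> powr q) \<partial>\<mu>) \<le> ennreal (2 powr (q + 1) * S powr q * ?V)"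
      using exponents by (intro nn_integral_powr_le[OF _ _ _ _ _ _ dev])
        (auto simp: continuous_borel_measurable[OF u] emeasure_ball)
    then have "(\<integral>\<^sup>+x\<in>ball w R. ennreal (\<bar>u x\<bar> powr q) \<partial>\<mu>) / emeasure \<mu> (ball w R)
        \<le> ennreal (2 powr (q + 1) * S powr q * ?V) / ennreal ?V"
      unfolding emeasure_ball by (rule divide_right_mono_ennreal)
    also have "\<dots> = ennreal (2 powr (q + 1) * S powr q)"
      using m by (simp add: divide_ennreal)
    finally have "?L \<le> epowr (ennreal (2 powr (q + 1) * S powr q)) (p / q)"
      using exponents by (intro epowr_mono) auto
    also have "\<dots> = ennreal ((2 powr (q + 1)) powr (p / q) * S powr p)"
      using exponents by (simp add: powr_mult powr_powr)
    also have "S powr p = (cP + K) powr p * R powr (s * p) * (g / ?m)"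
      using exponents m g by (simp add: S_def G_def powr_mult powr_powr)
    finally show ?thesis
      by (simp only: mult.assoc)
  qed
  show ?thesis
  proof (cases ?e)
    \<comment> \<open>With infinite energy the right-hand side is infinite, because its constant is
      positive.\<close>
    case top
    then have "?e / emeasure \<mu> (ball w (\<Lambda> * R)) = \<infinity>"
      by (simp add: emeasure_ball ennreal_top_divide)
    then show ?thesis
      using K cP R by (simp add: ennreal_mult_top)
  next
    case (real g)
    \<comment> \<open>The choice \<open>g + 1\<close> is positive and serves to show that the
      left-hand side is finite; the sharp bound follows by letting \<open>h\<close> decrease to
      \<open>g\<close>.\<close>
    have "?L \<le> ennreal (?C * ((g + 1) / ?m))"
      using real by (intro le) (auto simp: ennreal_leI)
    then obtain l where l: "?L = ennreal l" "0 \<le> l"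
      by (cases ?L) (auto simp: top_unique)
    have "l \<le> ?C * (g / ?m)"
    proof (rule tendsto_lowerbound[where F = "at_right g" and f = "\<lambda>h. ?C * (h / ?m)"])
      show "((\<lambda>h. ?C * (h / ?m)) \<longlongrightarrow> ?C * (g / ?m)) (at_right g)"
        using m by (intro tendsto_intros) auto
      show "\<forall>\<^sub>F h in at_right g. l \<le> ?C * (h / ?m)"
        using eventually_at_right_less[of g]
      proof eventually_elim
        case (elim h)
        then have h: "0 < h" "?e \<le> ennreal h"
          using real by (auto simp: ennreal_leI)
        then have "0 \<le> ?C * (h / ?m)"
          using C m by (intro mult_nonneg_nonneg) auto
        then show ?case
          using le[OF h(2,1)] unfolding l(1) by (simp only: ennreal_le_iff)
      qed
    qed simp
    then have "?L \<le> ennreal (?C * (g / ?m))"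
      unfolding l(1) by (rule ennreal_leI)
    also have "\<dots> = ennreal ?C * (?e / emeasure \<mu> (ball w (\<Lambda> * R)))"
      using C m real by (simp only: ennreal_mult' emeasure_ball divide_ennreal)
    finally show ?thesis .
  qed
qed

end

section \<open>Choice of the constants and conclusion\<close>

theorem theorem4p7:
  fixes \<mu> :: "'a::metric_space measure"
    and s p q t cP \<Lambda> \<kappa> cR :: real
    and E :: "'a set"
  assumes "metric_measure_space \<mu>"
    and "doubling_measure \<mu>"
    and "1 \<le> p" and "p \<le> q"
    and "0 < s" and "s < 1"
    and "1 \<le> t"
    and "complete (UNIV :: 'a set)"
    and "0 < cP" and "1 \<le> \<Lambda>"
    and "poincare_inequality \<mu> s q p t cP \<Lambda>"
    and "0 < \<kappa>" and "\<kappa> < 1" and "0 < cR" and "cR < 1"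
    and "reverse_doubling_measure \<mu> \<kappa> cR"
    and "closed E"
    and "upper_assouad_codim \<mu> E < ereal (s * p)"
  shows "\<exists>C>0. \<forall>u :: 'a \<Rightarrow> real. \<forall>w R.
    continuous_on UNIV u \<and> (\<forall>x\<in>E. u x = 0) \<and> w \<in> E \<and> 0 < R \<and> ennreal R < ediam E / 2 \<longrightarrow>
      epowr ((\<integral>\<^sup>+x\<in>ball w R. ennreal (\<bar>u x\<bar> powr q) \<partial>\<mu>) / emeasure \<mu> (ball w R)) (p / q)
      \<le> ennreal (C * R powr (s * p)) *
          (frac_energy \<mu> s p t (ball w (\<Lambda> * R)) u / emeasure \<mu> (ball w (\<Lambda> * R)))"
proof -
  obtain c where c: "1 \<le> c" "\<And>x r. 0 < r \<Longrightarrow> measure \<mu> (ball x (2 * r)) \<le> c * measure \<mu> (ball x r)"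
    using assms(2) unfolding doubling_measure_def by blast
  interpret doubling_space \<mu> c
    using assms(1) c by unfold_locales (auto simp: metric_measure_space_def)
  obtain \<epsilon> \<delta> where \<epsilon>: "0 < \<epsilon>" "\<epsilon> \<le> 1 / 4" and \<delta>: "\<epsilon> powr (s * p) < \<delta>"
    and children: "\<And>x r. \<lbrakk>x \<in> E; 0 < r; ennreal r < ediam E\<rbrakk> \<Longrightarrow> \<exists>S. finite S \<and> S \<subseteq> E \<inter> ball x (3 / 4 * r) \<and>
      disjoint_family_on (\<lambda>y. ball y (\<epsilon> * r)) S \<and>
      \<delta> * measure \<mu> (ball x r) \<le> (\<Sum>y\<in>S. measure \<mu> (ball y (\<epsilon> * r)))"
    by (rule thick_set_branching[OF assms(18)]) blast
  have \<delta>_pos: "0 < \<delta>"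
    using \<delta> by (rule le_less_trans[rotated]) simp
  \<comment> \<open>Taking p-th roots in \<open>\<epsilon> powr (s * p) < \<delta>\<close> is what
    makes the geometric series converge.\<close>
  have "(\<epsilon> powr (s * p)) powr (1 / p) < \<delta> powr (1 / p)"
    using \<delta> assms(3) by (intro powr_less_mono2) auto
  then have \<theta>: "\<epsilon> powr s / \<delta> powr (1 / p) < 1"
    using assms(3) \<delta>_pos by (simp add: powr_powr)
  obtain k where k: "2 * \<Lambda> + 1 < 2 ^ k"
    using real_arch_pow[of 2 "2 * \<Lambda> + 1"] by auto
  obtain j where "2 / \<epsilon> < 2 ^ j"
    using real_arch_pow[of 2 "2 / \<epsilon>"] by auto
  then have j: "2 \<le> 2 ^ j * \<epsilon>"
    using \<epsilon> by (simp add: pos_divide_less_eq)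
  \<comment> \<open>All ingredients are chosen before \<open>u\<close>, \<open>w\<close> and
    \<open>R\<close>, so the constant is uniform in them.\<close>
  define K where "K = 4 * c ^ j * cP * (c ^ k * c ^ k) powr (1 / p) / (1 - \<epsilon> powr s / \<delta> powr (1 / p))"
  define C where "C = (2 powr (q + 1)) powr (p / q) * (cP + K) powr p"
  have K: "0 < K"
    unfolding K_def using \<theta> assms(9) c(1) by (intro divide_pos_pos mult_pos_pos) auto
  have "0 < C"
    unfolding C_def using K assms(9) by simp
  moreover have "epowr ((\<integral>\<^sup>+x\<in>ball w R. ennreal (\<bar>u x\<bar> powr q) \<partial>\<mu>) / emeasure \<mu> (ball w R)) (p / q)
      \<le> ennreal (C * R powr (s * p)) *
          (frac_energy \<mu> s p t (ball w (\<Lambda> * R)) u / emeasure \<mu> (ball w (\<Lambda> * R)))"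
    if u: "continuous_on UNIV u" "\<And>x. x \<in> E \<Longrightarrow> u x = 0" and w: "w \<in> E"
      and R: "0 < R" "ennreal R < ediam E / 2" for u :: "'a \<Rightarrow> real" and w R
  proof -
    have half: "ediam E / 2 \<le> ediam E"
      by (cases "ediam E") (auto simp: ennreal_divide_numeral ennreal_top_divide intro!: ennreal_leI)
    \<comment> \<open>All radii in the tree are at most \<open>R\<close>, hence below the diameter
      of \<open>E\<close>, where \<open>children\<close> applies.\<close>
    have "ennreal r < ediam E" if "r \<le> R" for r
      using le_less_trans[OF ennreal_leI[OF that] less_le_trans[OF R(2) half]] .
    then interpret branching_set \<mu> c E \<epsilon> \<delta> \<Lambda> R w
      using \<epsilon> \<delta>_pos assms(10) R w children by unfold_locales auto
    show ?thesis
      unfolding C_def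
    proof (rule mazya_le)
      fix g assume "frac_energy \<mu> s p t (ball w (\<Lambda> * R)) u \<le> ennreal g" "0 < g"
      then show "\<bar>ball_average \<mu> (ball w R) u\<bar> \<le> K * R powr s * (g / measure \<mu> (ball w (\<Lambda> * R))) powr (1 / p)"
        unfolding K_def using assms u k j \<theta> by (intro average_le[where q = q]) auto
    qed (use assms u K in auto)
  qed
  ultimately show ?thesis by blast
qed

end
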